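(* Let $(X,d)$ be a proper, roughly geodesic, strongly hyperbolic metric space with base point $o\in X$, and let $\Gamma$ be a non-elementary discrete group of isometries of $(X,d)$ acting cocompactly on $X$. Put $|\gamma|=d(o,\gamma o)$ and let $\alpha$ be the volume growth of $\Gamma$. Then there exist $C>0$ and $\varepsilon\in(0,\frac12)$, a Hilbert space $\mathcal{H}$, and a family of representations $\rho_s:\Gamma\to\mathbb{B}(\mathcal{H})$, $s\in[0,\frac12]$, such that: (i) for all $s\in[0,\frac12)$ and all $\gamma\in\Gamma$, $$\|\rho_s(\gamma)\|_{op}\le C\,\frac{e^{|1-2s|\alpha|\gamma|}}{(1-e^{2s-1})^2};$$ (ii) $\rho_{\frac12}$ is a unitary representation; (iii) for every $s\in[0,\frac12-\varepsilon]$, $\rho_s$ admits a proper $1$-cocycle.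
   Context: Gromov product: $(x,y)_o=\frac12(d(x,o)+d(y,o)-d(x,y))$. $(X,d)$ is strongly hyperbolic if for some $\epsilon>0$, $e^{-\epsilon(x,y)_o}\le e^{-\epsilon(x,z)_o}+e^{-\epsilon(z,y)_o}$ for all $x,y,z,o\in X$. Roughly geodesic: there is $C_X>0$ such that any $x,y\in X$ are joined by a map $r:[a,b]\to X$, $r(a)=x$, $r(b)=y$, with $|t-u|-C_X\le d(r(t),r(u))\le|t-u|+C_X$. A discrete group of isometries is one acting properly discontinuously. Volume growth: $\alpha=\limsup_{T\to\infty}\frac1T\log|\Gamma o\cap B_X(o,T)|$. A representation of $\Gamma$ on $\mathcal{H}$ is a group homomorphism from $\Gamma$ to the group of invertible elements of the algebra $\mathbb{B}(\mathcal{H})$ of bounded operators on $\mathcal H$ (not necessarily unitary). A $1$-cocycle for $\rho$ is a map $b:\Gamma\to\mathcal{H}$ with $b(\gamma_1\gamma_2)=b(\gamma_1)+\rho(\gamma_1)b(\gamma_2)$ for all $\gamma_1,\gamma_2$; it is proper if $\|b(\gamma)\|\to+\infty$ as $|\gamma|\to+\infty$. *)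

theory Defs
  imports "HOL-Analysis.Analysis" "HOL-Algebra.Algebra" "HOL-Algebra.Algebraic_Closure_Type"
begin

definition proper_space :: "'x::metric_space itself \<Rightarrow> bool" where
  "proper_space _ \<longleftrightarrow> (\<forall>(x::'x) r. compact (cball x r))"

definition roughly_geodesic :: "'x::metric_space itself \<Rightarrow> bool" where
  "roughly_geodesic _ \<longleftrightarrow>
    (\<exists>C>0. \<forall>x y::'x. \<exists>a b (r :: real \<Rightarrow> 'x). a \<le> b \<and> r a = x \<and> r b = y \<and>
      (\<forall>t\<in>{a..b}. \<forall>u\<in>{a..b}.
        \<bar>t - u\<bar> - C \<le> dist (r t) (r u) \<and> dist (r t) (r u) \<le> \<bar>t - u\<bar> + C))"

definition gromov_product :: "'x::metric_space \<Rightarrow> 'x \<Rightarrow> 'x \<Rightarrow> real" where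
  "gromov_product z x y = (dist x z + dist y z - dist x y) / 2"

definition strongly_hyperbolic :: "'x::metric_space itself \<Rightarrow> bool" where
  "strongly_hyperbolic _ \<longleftrightarrow>
    (\<exists>\<epsilon>>0. \<forall>x y z w::'x.
      exp (- \<epsilon> * gromov_product w x y)
        \<le> exp (- \<epsilon> * gromov_product w x z) + exp (- \<epsilon> * gromov_product w z y))"

definition isometry_group :: "('x::metric_space \<Rightarrow> 'x) set \<Rightarrow> bool" where
  "isometry_group \<Gamma> \<longleftrightarrow>
    subgroup \<Gamma> (BijGroup UNIV) \<and> (\<forall>\<gamma>\<in>\<Gamma>. \<forall>x y. dist (\<gamma> x) (\<gamma> y) = dist x y)"

abbreviation group_of :: "('x \<Rightarrow> 'x) set \<Rightarrow> ('x \<Rightarrow> 'x) monoid" where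
  "group_of \<Gamma> \<equiv> (BijGroup UNIV)\<lparr>carrier := \<Gamma>\<rparr>"

definition properly_discontinuous :: "('x::metric_space \<Rightarrow> 'x) set \<Rightarrow> bool" where
  "properly_discontinuous \<Gamma> \<longleftrightarrow>
    (\<forall>K. compact K \<longrightarrow> finite {\<gamma>\<in>\<Gamma>. \<gamma> ` K \<inter> K \<noteq> {}})"

definition cocompact :: "('x::metric_space \<Rightarrow> 'x) set \<Rightarrow> bool" where
  "cocompact \<Gamma> \<longleftrightarrow> (\<exists>K. compact K \<and> (\<Union>\<gamma>\<in>\<Gamma>. \<gamma> ` K) = UNIV)"

definition orbit_of :: "('x \<Rightarrow> 'x) set \<Rightarrow> 'x \<Rightarrow> 'x set" where
  "orbit_of \<Gamma> z = (\<lambda>\<gamma>. \<gamma> z) ` \<Gamma>"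

text \<open>The Gromov boundary consists of the classes of sequences converging to infinity, i.e.
  \<open>(x\<^sub>i, x\<^sub>j)\<^sub>z \<longrightarrow> \<infinity>\<close> as \<open>i, j \<longrightarrow> \<infinity>\<close> independently, where \<open>(x\<^sub>i)\<close> and \<open>(y\<^sub>j)\<close> are
  identified if \<open>(x\<^sub>i, y\<^sub>j)\<^sub>z \<longrightarrow> \<infinity>\<close>. A point of it is a limit point of the group if some
  sequence in the orbit of the base point represents it.\<close>

definition converging_to_infinity :: "'x::metric_space \<Rightarrow> (nat \<Rightarrow> 'x) set" where
  "converging_to_infinity z =
    {xs. filterlim (\<lambda>(i, j). gromov_product z (xs i) (xs j)) at_top
           (sequentially \<times>\<^sub>F sequentially)}"

definition boundary_rel :: "'x::metric_space \<Rightarrow> ((nat \<Rightarrow> 'x) \<times> (nat \<Rightarrow> 'x)) set" where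
  "boundary_rel z =
    {(xs, ys). xs \<in> converging_to_infinity z \<and> ys \<in> converging_to_infinity z \<and>
       filterlim (\<lambda>(i, j). gromov_product z (xs i) (ys j)) at_top
         (sequentially \<times>\<^sub>F sequentially)}"

definition gromov_boundary :: "'x::metric_space \<Rightarrow> (nat \<Rightarrow> 'x) set set" where
  "gromov_boundary z = converging_to_infinity z // boundary_rel z"

definition limit_set :: "('x::metric_space \<Rightarrow> 'x) set \<Rightarrow> 'x \<Rightarrow> (nat \<Rightarrow> 'x) set set" where
  "limit_set \<Gamma> z = {\<xi>\<in>gromov_boundary z. \<exists>xs\<in>\<xi>. range xs \<subseteq> orbit_of \<Gamma> z}"

definition non_elementary :: "('x::metric_space \<Rightarrow> 'x) set \<Rightarrow> 'x \<Rightarrow> bool" where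
  "non_elementary \<Gamma> z \<longleftrightarrow> \<not> (finite (limit_set \<Gamma> z) \<and> card (limit_set \<Gamma> z) \<le> 2)"

text \<open>The \<open>limsup\<close> is taken in the extended reals; for a discrete cocompact group of isometries of
  a proper, roughly geodesic space it is finite, so that the conversion to \<^typ>\<open>real\<close> loses
  nothing.\<close>

definition volume_growth :: "('x::metric_space \<Rightarrow> 'x) set \<Rightarrow> 'x \<Rightarrow> real" where
  "volume_growth \<Gamma> z = real_of_ereal
     (Limsup at_top (\<lambda>T::real. ereal (ln (real (card (orbit_of \<Gamma> z \<inter> ball z T))) / T)))"

text \<open>A Hilbert space has an explicit carrier, so that one can quantify over Hilbert spaces (with
  elements in a given type). Elements of type \<open>nat \<Rightarrow> complex\<close> suffice for every Hilbert space of
  cardinality at most the continuum, in particular for every separable one, up to isometric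
  isomorphism. The ring multiplication and unit that the record type of modules
  inherits are irrelevant. The inner product is linear in its first argument.\<close>

record 'h chilbert = "(complex, 'h) module" +
  cinner :: "'h \<Rightarrow> 'h \<Rightarrow> complex"

definition hnorm :: "'h chilbert \<Rightarrow> 'h \<Rightarrow> real" where
  "hnorm H x = sqrt (Re (cinner H x x))"

locale chilbert_space = Module.module "ring_of_type_algebra :: complex ring" H
  for H :: "'h chilbert" (structure) +
  assumes cinner_add_left:
      "\<lbrakk>x \<in> carrier H; y \<in> carrier H; z \<in> carrier H\<rbrakk>
        \<Longrightarrow> cinner H (x \<oplus>\<^bsub>H\<^esub> y) z = cinner H x z + cinner H y z"
    and cinner_smult_left:
      "\<lbrakk>x \<in> carrier H; y \<in> carrier H\<rbrakk> \<Longrightarrow> cinner H (c \<odot>\<^bsub>H\<^esub> x) y = c * cinner H x y"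
    and cinner_commute:
      "\<lbrakk>x \<in> carrier H; y \<in> carrier H\<rbrakk> \<Longrightarrow> cinner H y x = cnj (cinner H x y)"
    and cinner_pos:
      "\<lbrakk>x \<in> carrier H; x \<noteq> \<zero>\<^bsub>H\<^esub>\<rbrakk> \<Longrightarrow> 0 < Re (cinner H x x)"
    and complete:
      "Metric_space.mcomplete (carrier H) (\<lambda>x y. hnorm H (x \<ominus>\<^bsub>H\<^esub> y))"

text \<open>The bounded operators are taken extensional, i.e. undefined off the carrier, so that an
  operator is determined by its values on the carrier.\<close>

definition bounded_operators :: "'h chilbert \<Rightarrow> ('h \<Rightarrow> 'h) set" where
  "bounded_operators H =
    {T \<in> carrier H \<rightarrow>\<^sub>E carrier H.
      (\<forall>x\<in>carrier H. \<forall>y\<in>carrier H. T (x \<oplus>\<^bsub>H\<^esub> y) = T x \<oplus>\<^bsub>H\<^esub> T y) \<and>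
      (\<forall>c. \<forall>x\<in>carrier H. T (c \<odot>\<^bsub>H\<^esub> x) = c \<odot>\<^bsub>H\<^esub> T x) \<and>
      (\<exists>K. \<forall>x\<in>carrier H. hnorm H (T x) \<le> K * hnorm H x)}"

definition operator_monoid :: "'h chilbert \<Rightarrow> ('h \<Rightarrow> 'h) monoid" where
  "operator_monoid H =
    \<lparr>carrier = bounded_operators H,
     mult = (\<lambda>S T. compose (carrier H) S T),
     one = (\<lambda>x\<in>carrier H. x)\<rparr>"

definition op_norm :: "'h chilbert \<Rightarrow> ('h \<Rightarrow> 'h) \<Rightarrow> real" where
  "op_norm H T = (SUP x\<in>{x\<in>carrier H. hnorm H x \<le> 1}. hnorm H (T x))"

definition unitary_operator :: "'h chilbert \<Rightarrow> ('h \<Rightarrow> 'h) \<Rightarrow> bool" where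
  "unitary_operator H U \<longleftrightarrow> U \<in> bounded_operators H \<and> U ` carrier H = carrier H \<and>
    (\<forall>x\<in>carrier H. \<forall>y\<in>carrier H. cinner H (U x) (U y) = cinner H x y)"

definition hilbert_representation ::
    "('g, 'm) monoid_scheme \<Rightarrow> 'h chilbert \<Rightarrow> ('g \<Rightarrow> 'h \<Rightarrow> 'h) \<Rightarrow> bool" where
  "hilbert_representation G H \<rho> \<longleftrightarrow> \<rho> \<in> hom G (units_of (operator_monoid H))"

definition unitary_representation ::
    "('g, 'm) monoid_scheme \<Rightarrow> 'h chilbert \<Rightarrow> ('g \<Rightarrow> 'h \<Rightarrow> 'h) \<Rightarrow> bool" where
  "unitary_representation G H \<rho> \<longleftrightarrow>
    hilbert_representation G H \<rho> \<and> (\<forall>g\<in>carrier G. unitary_operator H (\<rho> g))"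

definition cocycle ::
    "('g, 'm) monoid_scheme \<Rightarrow> 'h chilbert \<Rightarrow> ('g \<Rightarrow> 'h \<Rightarrow> 'h) \<Rightarrow> ('g \<Rightarrow> 'h) \<Rightarrow> bool" where
  "cocycle G H \<rho> b \<longleftrightarrow> b \<in> carrier G \<rightarrow> carrier H \<and>
    (\<forall>g1\<in>carrier G. \<forall>g2\<in>carrier G. b (g1 \<otimes>\<^bsub>G\<^esub> g2) = b g1 \<oplus>\<^bsub>H\<^esub> \<rho> g1 (b g2))"

definition proper_map_on ::
    "('g, 'm) monoid_scheme \<Rightarrow> ('g \<Rightarrow> real) \<Rightarrow> 'h chilbert \<Rightarrow> ('g \<Rightarrow> 'h) \<Rightarrow> bool" where
  "proper_map_on G len H b \<longleftrightarrow>
    (\<forall>M. \<exists>R. \<forall>g\<in>carrier G. len g \<ge> R \<longrightarrow> hnorm H (b g) \<ge> M)"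

end

(*
  H is l2(Gamma), and rho_s(g) f(x) = exp(-beta (|x| - |g^-1 x|)) f(g^-1 x) with
  beta = (1 - 2 s) alpha; this is the left regular representation twisted by the weight
  exp(-beta |x|), so its norm is at most exp(beta |g|), and it is unitary for s = 1/2. The function
  F(x) = exp(-beta |x|) |x| has the formal coboundary
  b(g)(x) = rho_s(g) F(x) - F(x) = exp(-beta |x|) (|g^-1 x| - |x|), which is square summable as soon
  as 2 beta > alpha, i.e. s < 1/4, and whose value at x = 1 is |g|, so that it is proper. It remains
  to see that 0 < alpha < infinity. Finiteness is the counting argument along rough geodesics. For
  positivity, three limit points give group elements a1, a2, a3 with long displacement and uniformly
  bounded mutual Gromov products, and the translates of this tripod contain a binary tree whose
  leaves are distinct orbit points.
*)

theory Submission
  imports Defs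
begin

section \<open>Square summable sequences\<close>

text \<open>Positivity of \<alpha> is what makes the construction possible: the weight decays at a
  rate proportional to \<alpha>, and for \<alpha> = 0 no s would give 2 \<beta> > \<alpha>. For s <
  1/4 the function F is itself square summable, since its factor |x| is absorbed by a slightly
  slower exponential; the cocycle is then an honest coboundary in the Hilbert space. A coboundary of
  a uniformly bounded representation is bounded, so properness comes precisely from the growth of
  the operator norms that (i) permits. The lower bound on growth uses hyperbolicity in its
  four-point form, where every comparison costs an additive error. The legs of the tripod are chosen
  long compared with that error, so that each vertex of the tree restores the same bound and nothing
  accumulates with the depth. The tree also shows that \<Gamma> is infinite, which lets square
  summable functions on \<Gamma> be realised as sequences indexed by all natural numbers.\<close>

definition l2_norm :: "(nat \<Rightarrow> complex) \<Rightarrow> real" where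
  "l2_norm f = sqrt (suminf (\<lambda>n. (cmod (f n))\<^sup>2))"

definition l2_part :: "(nat \<Rightarrow> complex) \<Rightarrow> nat \<Rightarrow> complex" where
  "l2_part f = (if summable (\<lambda>n. (cmod (f n))\<^sup>2) then f else (\<lambda>_. 0))"

text \<open>Addition discards summands off the carrier, because the constants of the locale
  \<^locale>\<open>Metric_space\<close> can only be unfolded for a distance that is symmetric and nonnegative on the
  whole type.\<close>

definition ell2 :: "(nat \<Rightarrow> complex) chilbert" where
  "ell2 = \<lparr>carrier = {f. summable (\<lambda>n. (cmod (f n))\<^sup>2)}, monoid.mult = (\<lambda>f g. f), one = (\<lambda>_. 0),
     ring.zero = (\<lambda>_. 0), add = (\<lambda>f g n. l2_part f n + l2_part g n), smult = (\<lambda>c f n. c * f n),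
     cinner = (\<lambda>f g. suminf (\<lambda>n. f n * cnj (g n)))\<rparr>"

lemma carrier_ell2: "f \<in> carrier ell2 \<longleftrightarrow> summable (\<lambda>n. (cmod (f n))\<^sup>2)"
  by (simp add: ell2_def)

lemma zero_ell2: "\<zero>\<^bsub>ell2\<^esub> = (\<lambda>_. 0)"
  and smult_ell2: "c \<odot>\<^bsub>ell2\<^esub> f = (\<lambda>n. c * f n)"
  and cinner_ell2: "cinner ell2 f g = suminf (\<lambda>n. f n * cnj (g n))"
  and add_ell2_l2_part: "f \<oplus>\<^bsub>ell2\<^esub> g = (\<lambda>n. l2_part f n + l2_part g n)"
  unfolding ell2_def by simp_all

lemma l2_part_eq [simp]: "f \<in> carrier ell2 \<Longrightarrow> l2_part f = f"
  by (simp add: l2_part_def carrier_ell2)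

lemma l2_part_closed [simp]: "l2_part f \<in> carrier ell2"
  by (simp add: l2_part_def carrier_ell2)

lemma add_ell2:
  "f \<in> carrier ell2 \<Longrightarrow> g \<in> carrier ell2 \<Longrightarrow> f \<oplus>\<^bsub>ell2\<^esub> g = (\<lambda>n. f n + g n)"
  by (simp add: add_ell2_l2_part)

lemma L2_set_le_l2_norm:
  assumes "f \<in> carrier ell2" "finite A"
  shows "L2_set (\<lambda>n. cmod (f n)) A \<le> l2_norm f"
  unfolding L2_set_def l2_norm_def
  using assms by (intro real_sqrt_le_mono sum_le_suminf) (auto simp: carrier_ell2)

lemma cmod_le_l2_norm:
  assumes "f \<in> carrier ell2"
  shows "cmod (f n) \<le> l2_norm f"
proof -
  have "cmod (f n) \<le> L2_set (\<lambda>n. cmod (f n)) {..<Suc n}"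
    by (rule member_le_L2_set) auto
  also have "\<dots> \<le> l2_norm f"
    by (rule L2_set_le_l2_norm[OF assms]) simp
  finally show ?thesis .
qed

text \<open>The common criterion for addition, the twisted operators and completeness: an estimate
  on finite blocks, uniform in their length, yields membership and norm bound at once. The empty
  block supplies K \<ge> 0.\<close>

lemma l2_norm_bound:
  assumes "\<And>N. L2_set (\<lambda>n. cmod (f n)) {..<N} \<le> K"
  shows "f \<in> carrier ell2" "l2_norm f \<le> K"
proof -
  have K: "K \<ge> 0"
    using assms[of 0] by simp
  have le: "(\<Sum>n<N. (cmod (f n))\<^sup>2) \<le> K\<^sup>2" for N
    using assms[of N] by (simp add: L2_set_def sqrt_le_D)
  show *: "f \<in> carrier ell2"
    unfolding carrier_ell2
    by (rule bounded_imp_summable[of _ "K\<^sup>2"]) (use le[of "Suc _"] in \<open>auto simp: lessThan_Suc_atMost\<close>)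
  have "suminf (\<lambda>n. (cmod (f n))\<^sup>2) \<le> K\<^sup>2"
    using * le by (intro suminf_le_const) (auto simp: carrier_ell2)
  then show "l2_norm f \<le> K"
    unfolding l2_norm_def using K by (intro real_le_lsqrt) auto
qed

lemma l2_norm_add:
  assumes "f \<in> carrier ell2" "g \<in> carrier ell2"
  shows "(\<lambda>n. f n + g n) \<in> carrier ell2" "l2_norm (\<lambda>n. f n + g n) \<le> l2_norm f + l2_norm g"
proof -
  have *: "L2_set (\<lambda>n. cmod (f n + g n)) {..<N} \<le> l2_norm f + l2_norm g" for N
  proof -
    have "L2_set (\<lambda>n. cmod (f n + g n)) {..<N} \<le> L2_set (\<lambda>n. cmod (f n) + cmod (g n)) {..<N}"
      by (intro L2_set_mono norm_triangle_ineq) auto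
    also have "\<dots> \<le> L2_set (\<lambda>n. cmod (f n)) {..<N} + L2_set (\<lambda>n. cmod (g n)) {..<N}"
      by (rule L2_set_triangle_ineq)
    also have "\<dots> \<le> l2_norm f + l2_norm g"
      by (intro add_mono L2_set_le_l2_norm assms finite_lessThan)
    finally show ?thesis .
  qed
  show "(\<lambda>n. f n + g n) \<in> carrier ell2" "l2_norm (\<lambda>n. f n + g n) \<le> l2_norm f + l2_norm g"
    by (rule l2_norm_bound[OF *])+
qed

lemma smult_closed_ell2:
  assumes "f \<in> carrier ell2"
  shows "(\<lambda>n. c * f n) \<in> carrier ell2"
  using summable_mult[of "\<lambda>n. (cmod (f n))\<^sup>2" "(cmod c)\<^sup>2"] assms
  by (simp add: carrier_ell2 norm_mult power_mult_distrib)

lemma uminus_closed_ell2: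
  assumes "f \<in> carrier ell2"
  shows "(\<lambda>n. - f n) \<in> carrier ell2"
  using assms by (simp add: carrier_ell2)

lemma diff_closed_ell2:
  assumes "f \<in> carrier ell2" "g \<in> carrier ell2"
  shows "(\<lambda>n. f n - g n) \<in> carrier ell2"
  using l2_norm_add(1)[OF assms(1) uminus_closed_ell2[OF assms(2)]] by simp

text \<open>Absolute convergence is recorded, rather than mere convergence, because unitarity at
  \<beta> = 0 permutes the terms of this series.\<close>

lemma abs_summable_cinner_ell2:
  assumes "f \<in> carrier ell2" "g \<in> carrier ell2"
  shows "summable (\<lambda>n. cmod (f n * cnj (g n)))"
proof (rule summable_comparison_test')
  show "summable (\<lambda>n. (cmod (f n))\<^sup>2 + (cmod (g n))\<^sup>2)"
    using assms by (intro summable_add) (auto simp: carrier_ell2)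
  show "norm (cmod (f n * cnj (g n))) \<le> (cmod (f n))\<^sup>2 + (cmod (g n))\<^sup>2" for n
    using sum_squares_bound[of "cmod (f n)" "cmod (g n)"]
      mult_nonneg_nonneg[of "cmod (f n)" "cmod (g n)"] norm_ge_zero[of "f n"] norm_ge_zero[of "g n"]
    unfolding real_norm_def abs_norm_cancel norm_mult complex_mod_cnj by linarith
qed

lemmas summable_cinner_ell2 = summable_norm_cancel[OF abs_summable_cinner_ell2]

lemma cinner_ell2_self:
  assumes "f \<in> carrier ell2"
  shows "cinner ell2 f f = complex_of_real (suminf (\<lambda>n. (cmod (f n))\<^sup>2))"
proof -
  have "f n * cnj (f n) = complex_of_real ((cmod (f n))\<^sup>2)" for n
    by (rule complex_norm_square[symmetric])
  then show ?thesis
    using assms by (simp only: cinner_ell2 carrier_ell2 suminf_of_real)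
qed

lemma hnorm_ell2: "hnorm ell2 f = l2_norm f" if "f \<in> carrier ell2"
  using that by (simp add: hnorm_def l2_norm_def cinner_ell2_self)

lemma abelian_group_ell2: "abelian_group ell2"
proof (rule abelian_groupI)
  fix f assume "f \<in> carrier ell2"
  then show "\<exists>g\<in>carrier ell2. g \<oplus>\<^bsub>ell2\<^esub> f = \<zero>\<^bsub>ell2\<^esub>"
    by (intro bexI[of _ "\<lambda>n. - f n"] uminus_closed_ell2)
      (auto simp: add_ell2 zero_ell2 uminus_closed_ell2)
qed (auto simp: add_ell2 l2_norm_add fun_eq_iff algebra_simps, auto simp: zero_ell2 carrier_ell2 add_ell2)

text \<open>Free of carrier hypotheses, so that the distance can be rewritten under a binder. The
  inverse is therefore computed from its definition, whose two laws see g only through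
  \<open>l2_part g\<close>.\<close>

lemma minus_ell2: "f \<ominus>\<^bsub>ell2\<^esub> g = (\<lambda>n. l2_part f n - l2_part g n)"
proof -
  have "\<ominus>\<^bsub>ell2\<^esub> g = (\<lambda>n. - l2_part g n)"
    unfolding a_inv_def m_inv_def
  proof (rule the_equality)
    show "(\<lambda>n. - l2_part g n) \<in> carrier (add_monoid ell2) \<and>
      g \<otimes>\<^bsub>add_monoid ell2\<^esub> (\<lambda>n. - l2_part g n) = \<one>\<^bsub>add_monoid ell2\<^esub> \<and>
      (\<lambda>n. - l2_part g n) \<otimes>\<^bsub>add_monoid ell2\<^esub> g = \<one>\<^bsub>add_monoid ell2\<^esub>"
      by (auto simp: add_ell2_l2_part zero_ell2 uminus_closed_ell2)
  next
    fix h
    assume "h \<in> carrier (add_monoid ell2) \<and> g \<otimes>\<^bsub>add_monoid ell2\<^esub> h = \<one>\<^bsub>add_monoid ell2\<^esub> \<and>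
      h \<otimes>\<^bsub>add_monoid ell2\<^esub> g = \<one>\<^bsub>add_monoid ell2\<^esub>"
    then show "h = (\<lambda>n. - l2_part g n)"
      by (auto simp: add_ell2_l2_part zero_ell2 fun_eq_iff add_eq_0_iff2)
  qed
  then show ?thesis
    by (simp add: a_minus_def add_ell2_l2_part uminus_closed_ell2)
qed

lemma module_ell2: "Module.module (ring_of_type_algebra :: complex ring) ell2"
proof (rule moduleI)
  show "cring (ring_of_type_algebra :: complex ring)"
    by (rule cring_from_type_algebra)
qed (auto intro!: abelian_group_ell2 smult_closed_ell2
      simp: smult_ell2 smult_closed_ell2 add_ell2 l2_norm_add ring_of_type_algebra_def algebra_simps)

lemma hnorm_minus_ell2:
  "hnorm ell2 (f \<ominus>\<^bsub>ell2\<^esub> g) = l2_norm (\<lambda>n. l2_part f n - l2_part g n)"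
  by (simp add: minus_ell2 hnorm_ell2 diff_closed_ell2)

lemma l2_norm_eq_0_iff:
  assumes "f \<in> carrier ell2"
  shows "l2_norm f = 0 \<longleftrightarrow> f = (\<lambda>_. 0)"
proof
  assume "l2_norm f = 0"
  then show "f = (\<lambda>_. 0)"
    using cmod_le_l2_norm[OF assms] by (auto simp: fun_eq_iff)
qed (simp add: l2_norm_def)

lemma l2_norm_nonneg:
  assumes "f \<in> carrier ell2"
  shows "l2_norm f \<ge> 0"
  using cmod_le_l2_norm[OF assms, of 0] norm_ge_zero[of "f 0"] by linarith

lemma Metric_space_ell2:
  "Metric_space (carrier ell2) (\<lambda>f g. hnorm ell2 (f \<ominus>\<^bsub>ell2\<^esub> g))"
  unfolding hnorm_minus_ell2
proof
  fix f g h :: "nat \<Rightarrow> complex"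
  show "0 \<le> l2_norm (\<lambda>n. l2_part f n - l2_part g n)"
    by (intro l2_norm_nonneg diff_closed_ell2) simp_all
  show "l2_norm (\<lambda>n. l2_part f n - l2_part g n) = l2_norm (\<lambda>n. l2_part g n - l2_part f n)"
    by (simp add: l2_norm_def norm_minus_commute)
  show "f \<in> carrier ell2 \<Longrightarrow> g \<in> carrier ell2 \<Longrightarrow>
      (l2_norm (\<lambda>n. l2_part f n - l2_part g n) = 0) = (f = g)"
    by (auto simp: l2_norm_eq_0_iff diff_closed_ell2 fun_eq_iff)
  show "l2_norm (\<lambda>n. l2_part f n - l2_part h n)
      \<le> l2_norm (\<lambda>n. l2_part f n - l2_part g n) + l2_norm (\<lambda>n. l2_part g n - l2_part h n)"
    using l2_norm_add(2)[OF diff_closed_ell2 diff_closed_ell2, of "l2_part f" "l2_part g" "l2_part g" "l2_part h"]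
    by simp
qed

lemma mcomplete_ell2:
  "Metric_space.mcomplete (carrier ell2) (\<lambda>f g. hnorm ell2 (f \<ominus>\<^bsub>ell2\<^esub> g))"
proof -
  interpret Metric_space "carrier ell2" "\<lambda>f g. hnorm ell2 (f \<ominus>\<^bsub>ell2\<^esub> g)"
    by (rule Metric_space_ell2)
  have "\<exists>f. limitin mtopology \<sigma> f sequentially" if \<sigma>: "MCauchy \<sigma>" for \<sigma>
  proof -
    have closed [simp]: "\<sigma> m \<in> carrier ell2" for m
      using \<sigma> by (auto simp: MCauchy_def)
    have cauchy: "\<exists>N. \<forall>m\<ge>N. \<forall>m'\<ge>N. l2_norm (\<lambda>n. \<sigma> m n - \<sigma> m' n) < \<epsilon>" if "\<epsilon> > 0" for \<epsilon>
    proof -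
      from \<sigma> that obtain N
        where "\<forall>m m'. N \<le> m \<longrightarrow> N \<le> m' \<longrightarrow> hnorm ell2 (\<sigma> m \<ominus>\<^bsub>ell2\<^esub> \<sigma> m') < \<epsilon>"
        unfolding MCauchy_def by blast
      then show ?thesis
        by (auto simp: hnorm_minus_ell2)
    qed
    have "convergent (\<lambda>m. \<sigma> m n)" for n
    proof (rule Cauchy_convergent, rule metric_CauchyI)
      fix \<epsilon> :: real
      assume "\<epsilon> > 0"
      from cauchy[OF this] obtain N
        where N: "\<forall>m\<ge>N. \<forall>m'\<ge>N. l2_norm (\<lambda>n. \<sigma> m n - \<sigma> m' n) < \<epsilon>" ..
      have "dist (\<sigma> m n) (\<sigma> m' n) \<le> l2_norm (\<lambda>n. \<sigma> m n - \<sigma> m' n)" for m m'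
        unfolding dist_norm by (rule cmod_le_l2_norm) (simp add: diff_closed_ell2)
      with N show "\<exists>N. \<forall>m\<ge>N. \<forall>m'\<ge>N. dist (\<sigma> m n) (\<sigma> m' n) < \<epsilon>"
        by (meson le_less_trans)
    qed
    then obtain f where f: "(\<lambda>m. \<sigma> m n) \<longlonglongrightarrow> f n" for n
      unfolding convergent_def by metis
    have close: "\<exists>N. \<forall>m\<ge>N. (\<lambda>n. \<sigma> m n - f n) \<in> carrier ell2 \<and> l2_norm (\<lambda>n. \<sigma> m n - f n) \<le> \<epsilon>"
      if "\<epsilon> > 0" for \<epsilon>
    proof -
      from cauchy[OF that] obtain N
        where N: "\<forall>m\<ge>N. \<forall>m'\<ge>N. l2_norm (\<lambda>n. \<sigma> m n - \<sigma> m' n) < \<epsilon>" ..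
      \<comment> \<open>On a finite block the norm is continuous in the coordinates, so the Cauchy
        estimate survives letting m' tend to infinity; it is then uniform in the block length
        M.\<close>
      have "L2_set (\<lambda>n. cmod (\<sigma> m n - f n)) {..<M} \<le> \<epsilon>" if "m \<ge> N" for m M
      proof (rule LIMSEQ_le_const2)
        show "(\<lambda>m'. L2_set (\<lambda>n. cmod (\<sigma> m n - \<sigma> m' n)) {..<M})
            \<longlonglongrightarrow> L2_set (\<lambda>n. cmod (\<sigma> m n - f n)) {..<M}"
          unfolding L2_set_def by (intro tendsto_intros f)
        have "L2_set (\<lambda>n. cmod (\<sigma> m n - \<sigma> m' n)) {..<M} \<le> \<epsilon>" if "m' \<ge> N" for m'
          using L2_set_le_l2_norm[OF diff_closed_ell2, of "\<sigma> m" "\<sigma> m'" "{..<M}"] N \<open>m \<ge> N\<close> that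
          by (meson closed finite_lessThan less_imp_le order_trans)
        then show "\<exists>N. \<forall>m'\<ge>N. L2_set (\<lambda>n. cmod (\<sigma> m n - \<sigma> m' n)) {..<M} \<le> \<epsilon>"
          by blast
      qed
      then have "(\<lambda>n. \<sigma> m n - f n) \<in> carrier ell2 \<and> l2_norm (\<lambda>n. \<sigma> m n - f n) \<le> \<epsilon>" if "m \<ge> N" for m
        using l2_norm_bound[of "\<lambda>n. \<sigma> m n - f n" \<epsilon>] that by blast
      then show ?thesis
        by blast
    qed
    \<comment> \<open>The limit is square summable because it is the difference of
      \<open>\<sigma> m\<close> and \<open>\<sigma> m - f\<close>, both of which are.\<close>
    from close[OF zero_less_one] obtain m where "(\<lambda>n. \<sigma> m n - f n) \<in> carrier ell2"
      by blast
    then have "f \<in> carrier ell2"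
      using diff_closed_ell2[of "\<sigma> m" "\<lambda>n. \<sigma> m n - f n"] by simp
    moreover have "\<exists>N. \<forall>m\<ge>N. l2_norm (\<lambda>n. \<sigma> m n - f n) < \<epsilon>" if "\<epsilon> > 0" for \<epsilon>
    proof -
      from close[of "\<epsilon> / 2"] that obtain N where "\<forall>m\<ge>N. l2_norm (\<lambda>n. \<sigma> m n - f n) \<le> \<epsilon> / 2"
        by auto
      with that have "\<forall>m\<ge>N. l2_norm (\<lambda>n. \<sigma> m n - f n) < \<epsilon>"
        by (auto intro: le_less_trans)
      then show ?thesis ..
    qed
    ultimately have "limitin mtopology \<sigma> f sequentially"
      unfolding limit_metric_sequentially by (simp add: hnorm_minus_ell2)
    then show ?thesis
      by (intro exI[of _ f])
  qed
  then show ?thesis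
    unfolding mcomplete_def by blast
qed

lemma chilbert_space_ell2: "chilbert_space ell2"
proof -
  interpret Module.module "ring_of_type_algebra :: complex ring" ell2
    by (rule module_ell2)
  show ?thesis
  proof
    fix f g h assume "f \<in> carrier ell2" "g \<in> carrier ell2" "h \<in> carrier ell2"
    then show "cinner ell2 (f \<oplus>\<^bsub>ell2\<^esub> g) h = cinner ell2 f h + cinner ell2 g h"
      by (simp add: cinner_ell2 add_ell2 suminf_add summable_cinner_ell2 distrib_right)
  next
    fix f g c assume fg: "f \<in> carrier ell2" "g \<in> carrier ell2"
    then show "cinner ell2 (c \<odot>\<^bsub>ell2\<^esub> f) g = c * cinner ell2 f g"
      by (simp add: cinner_ell2 smult_ell2 suminf_mult summable_cinner_ell2 mult.assoc)
    have "(\<lambda>n. f n * cnj (g n)) sums cinner ell2 f g"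
      unfolding cinner_ell2 using fg by (intro summable_sums summable_cinner_ell2)
    then have "(\<lambda>n. cnj (f n * cnj (g n))) sums cnj (cinner ell2 f g)"
      by (rule sums_cnj[THEN iffD2])
    then show "cinner ell2 g f = cnj (cinner ell2 f g)"
      unfolding cinner_ell2[of g f] by (simp add: sums_iff mult.commute)
  next
    fix f assume f: "f \<in> carrier ell2" "f \<noteq> \<zero>\<^bsub>ell2\<^esub>"
    then have "l2_norm f \<noteq> 0"
      by (simp add: l2_norm_eq_0_iff zero_ell2)
    then show "0 < Re (cinner ell2 f f)"
      using f l2_norm_nonneg[of f] by (simp add: cinner_ell2_self l2_norm_def less_le)
  qed (rule mcomplete_ell2)
qed

section \<open>The twisted regular representations\<close>

text \<open>Isolates what the operators need from |\<gamma>|; the geometry returns only as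
  summability of the weight. An infinite carrier makes the enumeration a bijection with all natural
  numbers, so that \<open>ell2\<close> serves as the space of square summable functions on the
  group.\<close>

locale countable_length_group = group G for G :: "('g, 'm) monoid_scheme" (structure) +
  fixes len :: "'g \<Rightarrow> real"
  assumes countable_carrier: "countable (carrier G)"
    and infinite_carrier: "infinite (carrier G)"
    and len_one: "len \<one> = 0"
    and len_inv: "g \<in> carrier G \<Longrightarrow> len (inv g) = len g"
    and len_mult: "\<lbrakk>g \<in> carrier G; h \<in> carrier G\<rbrakk> \<Longrightarrow> len (g \<otimes> h) \<le> len g + len h"
begin

definition elt :: "nat \<Rightarrow> 'g" where
  "elt = from_nat_into (carrier G)"

definition idx :: "'g \<Rightarrow> nat" where
  "idx = to_nat_on (carrier G)"

lemma elt_closed [simp]: "elt n \<in> carrier G"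
  unfolding elt_def using infinite_carrier by (intro from_nat_into) auto

lemma idx_elt [simp]: "idx (elt n) = n"
  unfolding elt_def idx_def by (rule to_nat_on_from_nat_into_infinite[OF countable_carrier infinite_carrier])

lemma elt_idx [simp]: "x \<in> carrier G \<Longrightarrow> elt (idx x) = x"
  unfolding elt_def idx_def by (rule from_nat_into_to_nat_on[OF countable_carrier])

lemma abs_len_mult_diff_le:
  assumes "g \<in> carrier G" "x \<in> carrier G"
  shows "\<bar>len (g \<otimes> x) - len x\<bar> \<le> len g"
proof -
  have "len (inv g \<otimes> (g \<otimes> x)) \<le> len (inv g) + len (g \<otimes> x)"
    using assms by (intro len_mult) auto
  then have "len x \<le> len g + len (g \<otimes> x)"
    using assms by (simp add: len_inv m_assoc[symmetric])
  with len_mult[OF assms] show ?thesis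
    by linarith
qed

lemma bij_translation:
  assumes "g \<in> carrier G"
  shows "bij (\<lambda>n. idx (g \<otimes> elt n))"
  by (rule o_bij[of "\<lambda>n. idx (inv g \<otimes> elt n)"])
    (use assms in \<open>auto simp: fun_eq_iff m_assoc[symmetric]\<close>)

definition twist :: "real \<Rightarrow> 'g \<Rightarrow> (nat \<Rightarrow> complex) \<Rightarrow> nat \<Rightarrow> complex" where
  "twist \<beta> g f n = complex_of_real (exp (\<beta> * (len (inv g \<otimes> elt n) - len (elt n)))) * f (idx (inv g \<otimes> elt n))"

text \<open>\<open>twist\<close> acts on all sequences, so its algebraic laws need no summability;
  the restriction makes the operator extensional, as \<open>bounded_operators\<close>
  demands.\<close>

definition twisted_rep :: "real \<Rightarrow> 'g \<Rightarrow> (nat \<Rightarrow> complex) \<Rightarrow> nat \<Rightarrow> complex" where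
  "twisted_rep \<beta> g = (\<lambda>f\<in>carrier ell2. twist \<beta> g f)"

lemma twist_one: "twist \<beta> \<one> f = f"
  by (simp add: twist_def fun_eq_iff)

text \<open>The weight is a quotient of values at two points, so the exponents telescope through the
  intermediate point \<open>inv g \<otimes> elt n\<close>.\<close>

lemma twist_mult:
  assumes "g \<in> carrier G" "h \<in> carrier G"
  shows "twist \<beta> (g \<otimes> h) f = twist \<beta> g (twist \<beta> h f)"
proof
  fix n
  let ?x = "inv g \<otimes> elt n"
  have x: "?x \<in> carrier G"
    using assms by simp
  have eq: "inv (g \<otimes> h) \<otimes> elt n = inv h \<otimes> ?x"
    using assms by (simp add: inv_mult_group m_assoc)
  have "exp (\<beta> * (len (inv h \<otimes> ?x) - len (elt n)))
      = exp (\<beta> * (len ?x - len (elt n))) * exp (\<beta> * (len (inv h \<otimes> ?x) - len ?x))"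
    by (simp add: exp_add[symmetric] algebra_simps)
  then show "twist \<beta> (g \<otimes> h) f n = twist \<beta> g (twist \<beta> h f) n"
    unfolding twist_def eq using x by simp
qed

text \<open>The length changes by at most \<open>len g\<close> under translation, so for \<beta>
  \<ge> 0 each weight is at most \<open>exp (\<beta> * len g)\<close>; the remaining translation
  sends a finite block injectively to another finite set of coordinates.\<close>

lemma twist_bounded:
  assumes g: "g \<in> carrier G" and f: "f \<in> carrier ell2" and \<beta>: "\<beta> \<ge> 0"
  shows "twist \<beta> g f \<in> carrier ell2" "l2_norm (twist \<beta> g f) \<le> exp (\<beta> * len g) * l2_norm f"
proof -
  let ?\<pi> = "\<lambda>n. idx (inv g \<otimes> elt n)"
  have inj: "inj_on ?\<pi> A" for A
    using bij_translation[of "inv g"] g by (auto intro: inj_on_subset bij_is_inj)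
  have *: "L2_set (\<lambda>n. cmod (twist \<beta> g f n)) {..<N} \<le> exp (\<beta> * len g) * l2_norm f" for N
  proof -
    have "L2_set (\<lambda>n. cmod (twist \<beta> g f n)) {..<N}
        \<le> L2_set (\<lambda>n. exp (\<beta> * len g) * cmod (f (?\<pi> n))) {..<N}"
    proof (rule L2_set_mono)
      fix n
      have "len (inv g \<otimes> elt n) - len (elt n) \<le> len g"
        using abs_len_mult_diff_le[of "inv g" "elt n"] g by (simp add: len_inv)
      with \<beta> show "cmod (twist \<beta> g f n) \<le> exp (\<beta> * len g) * cmod (f (?\<pi> n))"
        by (simp add: twist_def norm_mult mult_left_mono mult_right_mono)
    qed simp
    also have "\<dots> = exp (\<beta> * len g) * L2_set (\<lambda>n. cmod (f (?\<pi> n))) {..<N}"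
      by (simp add: L2_set_right_distrib)
    also have "L2_set (\<lambda>n. cmod (f (?\<pi> n))) {..<N} = L2_set (\<lambda>n. cmod (f n)) (?\<pi> ` {..<N})"
      by (simp add: L2_set_def sum.reindex[OF inj])
    also have "\<dots> \<le> l2_norm f"
      by (intro L2_set_le_l2_norm f) simp
    finally show ?thesis
      by (simp add: mult_left_mono)
  qed
  show "twist \<beta> g f \<in> carrier ell2" "l2_norm (twist \<beta> g f) \<le> exp (\<beta> * len g) * l2_norm f"
    by (rule l2_norm_bound[OF *])+
qed

lemma twisted_rep_bounded:
  assumes "g \<in> carrier G" "\<beta> \<ge> 0"
  shows "twisted_rep \<beta> g \<in> bounded_operators ell2"
proof -
  have "\<exists>K. \<forall>f\<in>carrier ell2. hnorm ell2 (twisted_rep \<beta> g f) \<le> K * hnorm ell2 f"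
    using assms by (intro exI[of _ "exp (\<beta> * len g)"])
      (simp add: twisted_rep_def hnorm_ell2 twist_bounded)
  then show ?thesis
    using assms unfolding bounded_operators_def twisted_rep_def
    by (auto simp: twist_bounded add_ell2 smult_ell2 l2_norm_add smult_closed_ell2 fun_eq_iff
      twist_def algebra_simps)
qed

lemma twisted_rep_mult:
  assumes "g \<in> carrier G" "h \<in> carrier G" "\<beta> \<ge> 0"
  shows "compose (carrier ell2) (twisted_rep \<beta> g) (twisted_rep \<beta> h) = twisted_rep \<beta> (g \<otimes> h)"
  using assms by (auto simp: fun_eq_iff compose_def twisted_rep_def twist_mult twist_bounded)

lemma twisted_rep_one: "twisted_rep \<beta> \<one> = (\<lambda>f\<in>carrier ell2. f)"
  by (simp add: twisted_rep_def twist_one)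

lemma twisted_rep_is_rep:
  assumes "\<beta> \<ge> 0"
  shows "hilbert_representation G ell2 (twisted_rep \<beta>)"
  unfolding hilbert_representation_def
proof (rule homI)
  fix g assume g: "g \<in> carrier G"
  then have "compose (carrier ell2) (twisted_rep \<beta> g) (twisted_rep \<beta> (inv g)) = (\<lambda>f\<in>carrier ell2. f)"
    "compose (carrier ell2) (twisted_rep \<beta> (inv g)) (twisted_rep \<beta> g) = (\<lambda>f\<in>carrier ell2. f)"
    using assms by (simp_all add: twisted_rep_mult twisted_rep_one)
  with g show "twisted_rep \<beta> g \<in> carrier (units_of (operator_monoid ell2))"
    unfolding units_of_carrier Units_def operator_monoid_def
    using assms by (auto intro!: bexI[of _ "twisted_rep \<beta> (inv g)"] twisted_rep_bounded)
next
  fix g h assume "g \<in> carrier G" "h \<in> carrier G"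
  with assms show "twisted_rep \<beta> (g \<otimes> h) = twisted_rep \<beta> g \<otimes>\<^bsub>units_of (operator_monoid ell2)\<^esub> twisted_rep \<beta> h"
    by (simp add: units_of_mult operator_monoid_def twisted_rep_mult)
qed

lemma op_norm_twisted_rep_le:
  assumes "g \<in> carrier G" "\<beta> \<ge> 0"
  shows "op_norm ell2 (twisted_rep \<beta> g) \<le> exp (\<beta> * len g)"
  unfolding op_norm_def
proof (rule cSUP_least)
  have "(\<lambda>_. 0) \<in> carrier ell2" "l2_norm (\<lambda>_. 0) = 0"
    by (simp_all add: carrier_ell2 l2_norm_def)
  then show "{f \<in> carrier ell2. hnorm ell2 f \<le> 1} \<noteq> {}"
    by (metis (mono_tags, lifting) empty_iff hnorm_ell2 mem_Collect_eq zero_le_one)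
  fix f assume "f \<in> {f \<in> carrier ell2. hnorm ell2 f \<le> 1}"
  then have f: "f \<in> carrier ell2" "l2_norm f \<le> 1"
    by (auto simp: hnorm_ell2)
  have "hnorm ell2 (twisted_rep \<beta> g f) = l2_norm (twist \<beta> g f)"
    using assms f by (simp add: twisted_rep_def hnorm_ell2 twist_bounded)
  also have "\<dots> \<le> exp (\<beta> * len g) * l2_norm f"
    by (rule twist_bounded(2)[OF assms(1) f(1) assms(2)])
  also have "\<dots> \<le> exp (\<beta> * len g)"
    using f by simp
  finally show "hnorm ell2 (twisted_rep \<beta> g f) \<le> exp (\<beta> * len g)" .
qed

lemma unitary_twisted_rep_0: "unitary_representation G ell2 (twisted_rep 0)"
  unfolding unitary_representation_def
proof (intro conjI ballI)
  show "hilbert_representation G ell2 (twisted_rep 0)"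
    by (rule twisted_rep_is_rep) simp
  fix g assume g: "g \<in> carrier G"
  have closed: "twisted_rep 0 h f \<in> carrier ell2" if "h \<in> carrier G" "f \<in> carrier ell2" for h f
    using that by (simp add: twisted_rep_def twist_bounded)
  have "twisted_rep 0 g (twisted_rep 0 (inv g) f) = f" if "f \<in> carrier ell2" for f
    using twisted_rep_mult[of g "inv g" 0, THEN fun_cong, of f] g that
    by (simp add: compose_def twisted_rep_one)
  then have "carrier ell2 \<subseteq> twisted_rep 0 g ` carrier ell2"
    using closed[OF inv_closed[OF g]] by (metis image_eqI subsetI)
  with closed[OF g] have "twisted_rep 0 g ` carrier ell2 = carrier ell2"
    by blast
  moreover have "cinner ell2 (twisted_rep 0 g f) (twisted_rep 0 g h) = cinner ell2 f h"
    if fh: "f \<in> carrier ell2" "h \<in> carrier ell2" for f h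
  proof -
    let ?\<pi> = "\<lambda>n. idx (inv g \<otimes> elt n)"
    have "(\<lambda>n. f n * cnj (h n)) sums cinner ell2 f h"
      unfolding cinner_ell2
      using fh by (intro summable_sums summable_cinner_ell2)
    \<comment> \<open>The unconditional sum \<open>has_sum\<close> is invariant under a bijection of
      the index set, which the ordered sum \<open>sums\<close> is not.\<close>
    then have "((\<lambda>n. f n * cnj (h n)) has_sum cinner ell2 f h) UNIV"
      using fh by (intro norm_summable_imp_has_sum abs_summable_cinner_ell2)
    then have "((\<lambda>n. f (?\<pi> n) * cnj (h (?\<pi> n))) has_sum cinner ell2 f h) UNIV"
      using g by (subst has_sum_reindex_bij_betw[OF bij_translation]) auto
    then have "(\<lambda>n. f (?\<pi> n) * cnj (h (?\<pi> n))) sums cinner ell2 f h"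
      by (rule has_sum_imp_sums)
    then show ?thesis
      using fh by (simp add: twisted_rep_def twist_def cinner_ell2 sums_iff)
  qed
  ultimately show "unitary_operator ell2 (twisted_rep 0 g)"
    using g by (simp add: unitary_operator_def twisted_rep_bounded)
qed

section \<open>The length cocycle\<close>

definition len_cocycle :: "real \<Rightarrow> 'g \<Rightarrow> nat \<Rightarrow> complex" where
  "len_cocycle \<beta> g n =
    complex_of_real (exp (- \<beta> * len (elt n)) * (len (inv g \<otimes> elt n) - len (elt n)))"

text \<open>For fixed g the difference of the two lengths is bounded by \<open>len g\<close>,
  uniformly in the point, so summability of the bare squared weight suffices.\<close>

lemma len_cocycle_closed:
  assumes g: "g \<in> carrier G" and sum: "summable (\<lambda>n. exp (- 2 * \<beta> * len (elt n)))"
  shows "len_cocycle \<beta> g \<in> carrier ell2"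
  unfolding carrier_ell2
proof (rule summable_comparison_test')
  show "summable (\<lambda>n. (len g)\<^sup>2 * exp (- 2 * \<beta> * len (elt n)))"
    using sum by (rule summable_mult)
  fix n
  have "\<bar>len (inv g \<otimes> elt n) - len (elt n)\<bar> \<le> len g"
    using abs_len_mult_diff_le[of "inv g" "elt n"] g by (simp add: len_inv)
  then have "(len (inv g \<otimes> elt n) - len (elt n))\<^sup>2 \<le> (len g)\<^sup>2"
    by (intro power2_le_iff_abs_le[THEN iffD2]) auto
  moreover have "(exp (- \<beta> * len (elt n)))\<^sup>2 = exp (- 2 * \<beta> * len (elt n))"
    by (simp add: power2_eq_square exp_add[symmetric])
  ultimately show "norm ((cmod (len_cocycle \<beta> g n))\<^sup>2) \<le> (len g)\<^sup>2 * exp (- 2 * \<beta> * len (elt n))"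
    unfolding len_cocycle_def norm_of_real real_norm_def power2_abs abs_power2 power_mult_distrib
    by (simp add: mult.commute mult_right_mono)
qed

lemma len_cocycle_proper_cocycle:
  assumes "\<beta> \<ge> 0" and sum: "summable (\<lambda>n. exp (- 2 * \<beta> * len (elt n)))"
  shows "cocycle G ell2 (twisted_rep \<beta>) (len_cocycle \<beta>)" "proper_map_on G len ell2 (len_cocycle \<beta>)"
proof -
  have closed: "len_cocycle \<beta> g \<in> carrier ell2" if "g \<in> carrier G" for g
    using that sum by (rule len_cocycle_closed)
  have "len_cocycle \<beta> (g \<otimes> h) = len_cocycle \<beta> g \<oplus>\<^bsub>ell2\<^esub> twisted_rep \<beta> g (len_cocycle \<beta> h)"
    if gh: "g \<in> carrier G" "h \<in> carrier G" for g h
  proof -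
    have "len_cocycle \<beta> (g \<otimes> h) n = len_cocycle \<beta> g n + twist \<beta> g (len_cocycle \<beta> h) n" for n
    proof -
      let ?x = "inv g \<otimes> elt n"
      have x: "?x \<in> carrier G"
        using gh by simp
      have eq: "inv (g \<otimes> h) \<otimes> elt n = inv h \<otimes> ?x"
        using gh by (simp add: inv_mult_group m_assoc)
      \<comment> \<open>The twisting factor carries the weight at \<open>?x\<close> back to the
        weight at \<open>elt n\<close>. All terms then share this weight and the length differences
        telescope.\<close>
      have "exp (\<beta> * (len ?x - len (elt n))) * exp (- \<beta> * len ?x) = exp (- \<beta> * len (elt n))"
        by (simp add: exp_add[symmetric] algebra_simps)
      then have "exp (- \<beta> * len (elt n)) * (len (inv h \<otimes> ?x) - len (elt n))
        = exp (- \<beta> * len (elt n)) * (len ?x - len (elt n))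
          + exp (\<beta> * (len ?x - len (elt n))) * (exp (- \<beta> * len ?x) * (len (inv h \<otimes> ?x) - len ?x))"
        unfolding mult.assoc[symmetric] by (simp add: algebra_simps)
      then show ?thesis
        unfolding twist_def len_cocycle_def eq elt_idx[OF x]
        by (simp only: of_real_mult[symmetric] of_real_add[symmetric])
    qed
    then show ?thesis
      using gh closed assms by (simp add: twisted_rep_def add_ell2 twist_bounded fun_eq_iff)
  qed
  with closed show "cocycle G ell2 (twisted_rep \<beta>) (len_cocycle \<beta>)"
    by (auto simp: cocycle_def)
  have "len g \<le> hnorm ell2 (len_cocycle \<beta> g)" if "g \<in> carrier G" for g
  proof -
    have "len g \<le> cmod (len_cocycle \<beta> g (idx \<one>))"
      using that by (simp add: len_cocycle_def len_one len_inv)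
    also have "\<dots> \<le> hnorm ell2 (len_cocycle \<beta> g)"
      using that closed by (simp add: hnorm_ell2 cmod_le_l2_norm)
    finally show ?thesis .
  qed
  then show "proper_map_on G len ell2 (len_cocycle \<beta>)"
    by (force simp: proper_map_on_def intro: order_trans)
qed

end

section \<open>Growth of discrete isometry groups\<close>

lemma gromov_product_commute: "gromov_product w x y = gromov_product w y x"
  by (simp add: gromov_product_def dist_commute add.commute)

lemma gromov_product_self [simp]: "gromov_product w x x = dist x w" "gromov_product w w x = 0"
  by (simp_all add: gromov_product_def dist_commute)

definition gromov_hyperbolic :: "'x::metric_space itself \<Rightarrow> real \<Rightarrow> bool" where
  "gromov_hyperbolic _ \<delta> \<longleftrightarrow> \<delta> \<ge> 0 \<and>
    (\<forall>x y z w::'x. min (gromov_product w x z) (gromov_product w z y) - \<delta> \<le> gromov_product w x y)"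

text \<open>A sum of two exponentials is at most twice the larger one; after taking logarithms the
  factor 2 becomes the additive error \<delta> = ln 2 / \<epsilon>.\<close>

lemma strongly_hyperbolic_imp_gromov_hyperbolic:
  assumes "strongly_hyperbolic TYPE('x::metric_space)"
  obtains \<delta> where "gromov_hyperbolic TYPE('x) \<delta>"
proof -
  from assms obtain \<epsilon> where \<epsilon>: "\<epsilon> > 0"
    and hyp: "\<And>x y z w::'x. exp (- \<epsilon> * gromov_product w x y)
        \<le> exp (- \<epsilon> * gromov_product w x z) + exp (- \<epsilon> * gromov_product w z y)"
    unfolding strongly_hyperbolic_def by blast
  have "min (gromov_product w x z) (gromov_product w z y) - ln 2 / \<epsilon> \<le> gromov_product w x y" for x y z w :: 'x
  proof -
    let ?m = "min (gromov_product w x z) (gromov_product w z y)"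
    have "exp (- \<epsilon> * gromov_product w x z) \<le> exp (- \<epsilon> * ?m)" "exp (- \<epsilon> * gromov_product w z y) \<le> exp (- \<epsilon> * ?m)"
      using \<epsilon> by auto
    with hyp[of w x y z] have "exp (- \<epsilon> * gromov_product w x y) \<le> 2 * exp (- \<epsilon> * ?m)"
      by linarith
    also have "\<dots> = exp (ln 2 - \<epsilon> * ?m)"
      by (simp add: exp_diff exp_minus field_simps)
    finally have "\<epsilon> * ?m - ln 2 \<le> \<epsilon> * gromov_product w x y"
      by simp
    with \<epsilon> show ?thesis
      by (simp add: field_simps)
  qed
  with \<epsilon> show ?thesis
    by (intro that[of "ln 2 / \<epsilon>"]) (simp add: gromov_hyperbolic_def)
qed

text \<open>Disjunctive form of the bound by a minimum, ready for linear arithmetic: applications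
  below usually refute one alternative and keep the other.\<close>

lemma gromov_hyperbolicD:
  assumes "gromov_hyperbolic TYPE('x::metric_space) \<delta>"
  shows "gromov_product w x z \<le> gromov_product w x (y::'x) + \<delta> \<or> gromov_product w z y \<le> gromov_product w x y + \<delta>"
proof -
  have "min (gromov_product w x z) (gromov_product w z y) - \<delta> \<le> gromov_product w x y"
    using assms by (auto simp: gromov_hyperbolic_def)
  then show ?thesis
    by linarith
qed

lemma filterlim_at_top_prod_sequentially:
  fixes f :: "nat \<Rightarrow> nat \<Rightarrow> real"
  shows "filterlim (\<lambda>(i, j). f i j) at_top (sequentially \<times>\<^sub>F sequentially)
    \<longleftrightarrow> (\<forall>K. \<exists>N. \<forall>i\<ge>N. \<forall>j\<ge>N. K \<le> f i j)"
  unfolding filterlim_at_top eventually_prod_sequentially by (simp, meson)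

lemma converging_to_infinity_iff:
  "xs \<in> converging_to_infinity z \<longleftrightarrow> (\<forall>K. \<exists>N. \<forall>i\<ge>N. \<forall>j\<ge>N. K \<le> gromov_product z (xs i) (xs j))"
  by (simp add: converging_to_infinity_def filterlim_at_top_prod_sequentially)

lemma boundary_rel_iff:
  "(xs, ys) \<in> boundary_rel z \<longleftrightarrow> xs \<in> converging_to_infinity z \<and> ys \<in> converging_to_infinity z \<and>
    (\<forall>K. \<exists>N. \<forall>i\<ge>N. \<forall>j\<ge>N. K \<le> gromov_product z (xs i) (ys j))"
  by (simp add: boundary_rel_def filterlim_at_top_prod_sequentially)

text \<open>Transitivity is where hyperbolicity enters: one late term of the middle sequence is
  close in direction to both outer ones, at a loss of \<delta>. The equivalence is what makes
  representatives of distinct boundary points unrelated.\<close>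

lemma equiv_boundary_rel:
  fixes z :: "'x::metric_space"
  assumes hyp: "gromov_hyperbolic TYPE('x) \<delta>"
  shows "equiv (converging_to_infinity z) (boundary_rel z)"
proof (rule equivI)
  show "boundary_rel z \<subseteq> converging_to_infinity z \<times> converging_to_infinity z"
    by (auto simp: boundary_rel_def)
  show "refl_on (converging_to_infinity z) (boundary_rel z)"
    by (auto simp: refl_on_def boundary_rel_iff converging_to_infinity_iff)
  show "sym (boundary_rel z)"
    by (rule symI) (simp add: boundary_rel_iff gromov_product_commute, meson)
  show "trans (boundary_rel z)"
  proof (rule transI)
    fix xs ys us
    assume xy: "(xs, ys) \<in> boundary_rel z" and yu: "(ys, us) \<in> boundary_rel z"
    have "\<exists>N. \<forall>i\<ge>N. \<forall>j\<ge>N. K \<le> gromov_product z (xs i) (us j)" for K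
    proof -
      from xy obtain N1 where N1: "\<And>i j. i \<ge> N1 \<Longrightarrow> j \<ge> N1 \<Longrightarrow> K + \<delta> \<le> gromov_product z (xs i) (ys j)"
        unfolding boundary_rel_iff by meson
      from yu obtain N2 where N2: "\<And>i j. i \<ge> N2 \<Longrightarrow> j \<ge> N2 \<Longrightarrow> K + \<delta> \<le> gromov_product z (ys i) (us j)"
        unfolding boundary_rel_iff by meson
      have "K \<le> gromov_product z (xs i) (us j)" if "i \<ge> max N1 N2" "j \<ge> max N1 N2" for i j
        using gromov_hyperbolicD[OF hyp, of z "xs i" "ys (max N1 N2)" "us j"]
          N1[of i "max N1 N2"] N2[of "max N1 N2" j] that by auto
      then show ?thesis
        by blast
    qed
    with xy yu show "(xs, us) \<in> boundary_rel z"
      by (simp add: boundary_rel_iff)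
  qed
qed

text \<open>Non-divergence alone gives only some late pairs with product below K. Since each
  sequence converges to infinity, such a pair can be replaced by any late pair, one index at a time,
  each replacement costing \<delta>; the thresholds K + \<delta> and K + 2 \<delta> exclude the
  unwanted alternative of the four-point inequality.\<close>

lemma gromov_product_bounded_if_not_boundary_rel:
  fixes z :: "'x::metric_space"
  assumes hyp: "gromov_hyperbolic TYPE('x) \<delta>"
    and xs: "xs \<in> converging_to_infinity z" and ys: "ys \<in> converging_to_infinity z"
    and "(xs, ys) \<notin> boundary_rel z"
  shows "\<exists>c N. \<forall>i\<ge>N. \<forall>j\<ge>N. gromov_product z (xs i) (ys j) \<le> c"
proof -
  from assms obtain K where K: "\<And>N. \<exists>i\<ge>N. \<exists>j\<ge>N. gromov_product z (xs i) (ys j) < K"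
    unfolding boundary_rel_iff by (meson not_le)
  from xs obtain N1 where N1: "\<And>i j. i \<ge> N1 \<Longrightarrow> j \<ge> N1 \<Longrightarrow> K + \<delta> \<le> gromov_product z (xs i) (xs j)"
    unfolding converging_to_infinity_iff by meson
  from ys obtain N2 where N2: "\<And>i j. i \<ge> N2 \<Longrightarrow> j \<ge> N2 \<Longrightarrow> K + 2 * \<delta> \<le> gromov_product z (ys i) (ys j)"
    unfolding converging_to_infinity_iff by meson
  have "gromov_product z (xs m) (ys n) \<le> K + 2 * \<delta>" if "m \<ge> max N1 N2" "n \<ge> max N1 N2" for m n
  proof -
    from K obtain i j where ij: "i \<ge> max N1 N2" "j \<ge> max N1 N2" "gromov_product z (xs i) (ys j) < K"
      by blast
    have "gromov_product z (xs m) (ys j) < K + \<delta>"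
      using gromov_hyperbolicD[OF hyp, of z "xs i" "xs m" "ys j"] N1[of i m] ij that by auto
    then show ?thesis
      using gromov_hyperbolicD[OF hyp, of z "xs m" "ys n" "ys j"] N2[of n j] ij that by auto
  qed
  then show ?thesis
    by blast
qed

section \<open>Exponential sums over sets of exponential growth\<close>

lemma ln_le_iff_le_exp: "0 < x \<Longrightarrow> ln x \<le> y \<longleftrightarrow> x \<le> exp y" for x y :: real
  using ln_le_cancel_iff[of x "exp y"] by simp

text \<open>Unit shells k \<le> l < k + 1 contribute terms dominated by a geometric series of ratio
  exp (u - t). A bound uniform over finite subsets can be transferred to any enumeration of
  S.\<close>

lemma sum_exp_bounded_if_exponential_growth:
  fixes l :: "'a \<Rightarrow> real"
  assumes nonneg: "\<And>x. x \<in> S \<Longrightarrow> l x \<ge> 0"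
    and fin: "\<And>T. finite {x\<in>S. l x < T}"
    and growth: "eventually (\<lambda>T. real (card {x\<in>S. l x < T}) \<le> D * exp (u * T)) at_top"
    and u: "0 \<le> u" "u < t"
  obtains B where "\<And>F. finite F \<Longrightarrow> F \<subseteq> S \<Longrightarrow> (\<Sum>x\<in>F. exp (- t * l x)) \<le> B"
proof -
  define N where "N T = real (card {x\<in>S. l x < T})" for T
  have N_mono: "N T \<le> N T'" if "T \<le> T'" for T T'
    unfolding N_def using that by (intro of_nat_mono card_mono fin) auto
  from growth obtain T0 where T0: "\<And>T. T \<ge> T0 \<Longrightarrow> N T \<le> D * exp (u * T)"
    unfolding eventually_at_top_linorder N_def by blast
  \<comment> \<open>The growth hypothesis speaks only of T \<ge> T0. For smaller T \<ge> 0,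
    monotonicity bounds the count by \<open>N T0\<close>, and exp (u T) \<ge> 1 since u \<ge> 0, so
    one constant covers both ranges.\<close>
  define E where "E = max D (N T0)"
  have E: "E \<ge> 0" "E \<ge> D" "E \<ge> N T0"
    by (auto simp: E_def N_def)
  have N_le: "N T \<le> E * exp (u * T)" if "T \<ge> 0" for T
  proof (cases "T \<ge> T0")
    case True
    have "D * exp (u * T) \<le> E * exp (u * T)"
      using E by (intro mult_right_mono) auto
    with T0[OF True] show ?thesis
      by linarith
  next
    case False
    then have "N T \<le> E * 1"
      using N_mono[of T T0] E by simp
    also have "\<dots> \<le> E * exp (u * T)"
      using E u that by (intro mult_left_mono) auto
    finally show ?thesis .
  qed
  define r where "r = exp (u - t)"
  have r: "0 < r" "r < 1"
    using u by (auto simp: r_def)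
  have "(\<Sum>x\<in>F. exp (- t * l x)) \<le> E * exp u * (1 / (1 - r))" if F: "finite F" "F \<subseteq> S" for F
  proof -
    let ?g = "\<lambda>x. nat \<lfloor>l x\<rfloor>"
    define M where "M = Suc (Max (insert 0 (?g ` F)))"
    have "?g ` F \<subseteq> {..<M}"
      using F by (auto simp: M_def less_Suc_eq_le)
    then have "(\<Sum>x\<in>F. exp (- t * l x)) = (\<Sum>k<M. \<Sum>x\<in>{x\<in>F. ?g x = k}. exp (- t * l x))"
      using F by (intro sum.group[symmetric]) auto
    also have "\<dots> \<le> (\<Sum>k<M. E * exp u * r ^ k)"
    proof (rule sum_mono)
      fix k
      have "(\<Sum>x\<in>{x\<in>F. ?g x = k}. exp (- t * l x)) \<le> (\<Sum>x\<in>{x\<in>F. ?g x = k}. exp (- t * real k))"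
      proof (rule sum_mono)
        fix x assume "x \<in> {x\<in>F. ?g x = k}"
        with F nonneg have "real k \<le> l x"
          by auto
        with u show "exp (- t * l x) \<le> exp (- t * real k)"
          by simp
      qed
      also have "\<dots> = card {x\<in>F. ?g x = k} * exp (- t * real k)"
        by simp
      also have "\<dots> \<le> N (real k + 1) * exp (- t * real k)"
      proof (rule mult_right_mono)
        have "{x\<in>F. ?g x = k} \<subseteq> {x\<in>S. l x < real k + 1}"
          using F by (auto, linarith)
        then show "real (card {x\<in>F. ?g x = k}) \<le> N (real k + 1)"
          unfolding N_def by (intro of_nat_mono card_mono fin)
      qed simp
      also have "\<dots> \<le> E * exp (u * (real k + 1)) * exp (- t * real k)"
        by (intro mult_right_mono N_le) auto
      also have "\<dots> = E * exp u * r ^ k"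
        unfolding r_def exp_of_nat_mult[symmetric] mult.assoc exp_add[symmetric] by (simp add: algebra_simps)
      finally show "(\<Sum>x\<in>{x\<in>F. ?g x = k}. exp (- t * l x)) \<le> E * exp u * r ^ k" .
    qed
    also have "\<dots> = E * exp u * (\<Sum>k<M. r ^ k)"
      by (simp add: sum_distrib_left)
    also have "\<dots> \<le> E * exp u * suminf (\<lambda>k. r ^ k)"
      using r E by (intro mult_left_mono sum_le_suminf summable_geometric) auto
    also have "suminf (\<lambda>k. r ^ k) = 1 / (1 - r)"
      using r by (intro suminf_geometric) auto
    finally show ?thesis .
  qed
  then show ?thesis
    by (rule that)
qed

section \<open>Discrete isometry groups: counting elements and orbit points\<close>

locale discrete_isometry_group =
  fixes \<Gamma> :: "('x::metric_space \<Rightarrow> 'x) set" and z :: 'x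
  assumes proper: "proper_space TYPE('x)"
    and isometries: "isometry_group \<Gamma>"
    and discrete: "properly_discontinuous \<Gamma>"
begin

lemma subgroup_BijGroup: "subgroup \<Gamma> (BijGroup UNIV)"
  using isometries by (simp add: isometry_group_def)

lemma bij_elem: "\<gamma> \<in> \<Gamma> \<Longrightarrow> bij \<gamma>"
  using subgroup.subset[OF subgroup_BijGroup] by (auto simp: BijGroup_def Bij_def)

lemma Bij_elem: "\<gamma> \<in> \<Gamma> \<Longrightarrow> \<gamma> \<in> Bij UNIV"
  using bij_elem by (auto simp: Bij_def)

lemma mult_eq_comp: "\<lbrakk>g \<in> \<Gamma>; h \<in> \<Gamma>\<rbrakk> \<Longrightarrow> g \<otimes>\<^bsub>BijGroup UNIV\<^esub> h = g \<circ> h"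
  by (simp add: BijGroup_def Bij_elem compose_def fun_eq_iff)

lemma one_eq_id: "\<one>\<^bsub>BijGroup UNIV\<^esub> = id"
  by (simp add: BijGroup_def fun_eq_iff)

lemma id_closed: "id \<in> \<Gamma>"
  using subgroup.one_closed[OF subgroup_BijGroup] by (simp add: one_eq_id)

lemma comp_closed: "\<lbrakk>g \<in> \<Gamma>; h \<in> \<Gamma>\<rbrakk> \<Longrightarrow> g \<circ> h \<in> \<Gamma>"
  using subgroup.m_closed[OF subgroup_BijGroup] by (simp add: mult_eq_comp)

lemma m_inv_eq_inv: "\<gamma> \<in> \<Gamma> \<Longrightarrow> inv\<^bsub>BijGroup UNIV\<^esub> \<gamma> = inv_into UNIV \<gamma>"
  by (simp add: inv_BijGroup Bij_elem fun_eq_iff)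

lemma inv_into_closed: "\<gamma> \<in> \<Gamma> \<Longrightarrow> inv_into UNIV \<gamma> \<in> \<Gamma>"
  using subgroup.m_inv_closed[OF subgroup_BijGroup] by (simp add: m_inv_eq_inv)

lemma apply_inv_into: "\<gamma> \<in> \<Gamma> \<Longrightarrow> \<gamma> (inv_into UNIV \<gamma> x) = x"
  using bij_elem by (simp add: bij_is_surj surj_f_inv_f)

lemma inv_into_apply: "\<gamma> \<in> \<Gamma> \<Longrightarrow> inv_into UNIV \<gamma> (\<gamma> x) = x"
  using bij_elem by (simp add: bij_is_inj)

lemma dist_elem: "\<gamma> \<in> \<Gamma> \<Longrightarrow> dist (\<gamma> x) (\<gamma> y) = dist x y"
  using isometries by (simp add: isometry_group_def)

lemma gromov_product_elem:
  "\<gamma> \<in> \<Gamma> \<Longrightarrow> gromov_product (\<gamma> w) (\<gamma> x) (\<gamma> y) = gromov_product w x y"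
  by (simp add: gromov_product_def dist_elem)

lemma dist_inv_into: "\<gamma> \<in> \<Gamma> \<Longrightarrow> dist z (inv_into UNIV \<gamma> z) = dist z (\<gamma> z)"
  by (metis dist_elem apply_inv_into dist_commute)

lemma dist_comp: "\<lbrakk>g \<in> \<Gamma>; h \<in> \<Gamma>\<rbrakk> \<Longrightarrow> dist z ((g \<circ> h) z) \<le> dist z (g z) + dist z (h z)"
  using dist_triangle[of z "g (h z)" "g z"] dist_elem[of g z "h z"] by simp

text \<open>Closed balls are compact by properness, and an element moving z by at most R makes the
  ball of radius R meet its image.\<close>

lemma finite_le: "finite {\<gamma>\<in>\<Gamma>. dist z (\<gamma> z) \<le> R}"
proof (rule finite_subset)
  show "finite {\<gamma>\<in>\<Gamma>. \<gamma> ` cball z R \<inter> cball z R \<noteq> {}}"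
    using discrete proper unfolding properly_discontinuous_def proper_space_def by blast
  have "\<gamma> z \<in> \<gamma> ` cball z R \<inter> cball z R" if "dist z (\<gamma> z) \<le> R" for \<gamma>
    using that zero_le_dist[of z "\<gamma> z"] by (simp del: zero_le_dist)
  then show "{\<gamma>\<in>\<Gamma>. dist z (\<gamma> z) \<le> R} \<subseteq> {\<gamma>\<in>\<Gamma>. \<gamma> ` cball z R \<inter> cball z R \<noteq> {}}"
    by blast
qed

lemma finite_less: "finite {\<gamma>\<in>\<Gamma>. dist z (\<gamma> z) < R}"
  by (rule finite_subset[OF _ finite_le[of R]]) auto

lemma countable_group: "countable \<Gamma>"
proof -
  have "\<Gamma> = (\<Union>n. {\<gamma>\<in>\<Gamma>. dist z (\<gamma> z) \<le> real n})"
    using real_arch_simple by auto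
  moreover have "countable (\<Union>n. {\<gamma>\<in>\<Gamma>. dist z (\<gamma> z) \<le> real n})"
    by (intro countable_UN) (auto intro!: countable_finite finite_le)
  ultimately show ?thesis
    by simp
qed

lemma orbit_Int_ball: "orbit_of \<Gamma> z \<inter> ball z T = (\<lambda>\<gamma>. \<gamma> z) ` {\<gamma>\<in>\<Gamma>. dist z (\<gamma> z) < T}"
  by (auto simp: orbit_of_def)

lemma finite_orbit_Int_ball: "finite (orbit_of \<Gamma> z \<inter> ball z T)"
  unfolding orbit_Int_ball by (intro finite_imageI finite_less)

lemma card_orbit_le: "card (orbit_of \<Gamma> z \<inter> ball z T) \<le> card {\<gamma>\<in>\<Gamma>. dist z (\<gamma> z) < T}"
  unfolding orbit_Int_ball by (intro card_image_le finite_less)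

lemma card_orbit_pos:
  assumes "T > 0"
  shows "card (orbit_of \<Gamma> z \<inter> ball z T) > 0"
proof -
  have "z \<in> orbit_of \<Gamma> z \<inter> ball z T"
    using id_closed assms by (auto simp: orbit_of_def intro: image_eqI[of z _ id])
  then show ?thesis
    using finite_orbit_Int_ball by (auto simp: card_gt_0_iff)
qed

text \<open>Fibres of the orbit map are cosets of the stabilizer, which is finite by discreteness.
  This passes from orbit points, which define the volume growth, to group elements, over which the
  series is summed.\<close>

lemma card_le_stabilizer_card_orbit:
  "card {\<gamma>\<in>\<Gamma>. dist z (\<gamma> z) < T} \<le> card {\<gamma>\<in>\<Gamma>. \<gamma> z = z} * card (orbit_of \<Gamma> z \<inter> ball z T)"
proof -
  define rep where "rep p = (SOME \<gamma>. \<gamma> \<in> \<Gamma> \<and> \<gamma> z = p)" for p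
  have rep: "rep (\<gamma> z) \<in> \<Gamma>" "rep (\<gamma> z) z = \<gamma> z" if "\<gamma> \<in> \<Gamma>" for \<gamma>
    using someI[of "\<lambda>g. g \<in> \<Gamma> \<and> g z = \<gamma> z" \<gamma>] that by (auto simp: rep_def)
  let ?S = "{\<gamma>\<in>\<Gamma>. \<gamma> z = z}" and ?P = "orbit_of \<Gamma> z \<inter> ball z T"
  have finS: "finite ?S"
    by (rule finite_subset[OF _ finite_le[of 0]]) auto
  have "{\<gamma>\<in>\<Gamma>. dist z (\<gamma> z) < T} \<subseteq> (\<lambda>(s, p). rep p \<circ> s) ` (?S \<times> ?P)"
  proof
    fix \<gamma> assume "\<gamma> \<in> {\<gamma>\<in>\<Gamma>. dist z (\<gamma> z) < T}"
    then have \<gamma>: "\<gamma> \<in> \<Gamma>" and P: "\<gamma> z \<in> ?P"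
      by (auto simp: orbit_of_def)
    let ?g = "rep (\<gamma> z)"
    have "inv_into UNIV ?g \<circ> \<gamma> \<in> ?S"
      using rep[OF \<gamma>] inv_into_apply[of ?g z] by (simp add: comp_closed inv_into_closed \<gamma>)
    moreover have "\<gamma> = ?g \<circ> (inv_into UNIV ?g \<circ> \<gamma>)"
      using rep[OF \<gamma>] by (simp add: fun_eq_iff apply_inv_into)
    ultimately show "\<gamma> \<in> (\<lambda>(s, p). rep p \<circ> s) ` (?S \<times> ?P)"
      using P by (intro image_eqI[of _ _ "(inv_into UNIV ?g \<circ> \<gamma>, \<gamma> z)"]) auto
  qed
  then have "card {\<gamma>\<in>\<Gamma>. dist z (\<gamma> z) < T} \<le> card (?S \<times> ?P)"
    using finS finite_orbit_Int_ball by (intro surj_card_le) auto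
  then show ?thesis
    by (simp add: card_cartesian_product)
qed

text \<open>Stepping back by a fixed amount along a rough geodesic from \<open>z\<close> to \<open>\<gamma> z\<close> and moving to a
  nearby orbit point shortens \<open>\<gamma>\<close> by right multiplication with a bounded element.\<close>

lemma exponential_growth_bound:
  assumes "roughly_geodesic TYPE('x)" and "cocompact \<Gamma>"
  obtains B where "eventually (\<lambda>T. real (card {\<gamma>\<in>\<Gamma>. dist z (\<gamma> z) < T}) \<le> exp (B * T)) at_top"
proof -
  from assms(1) obtain C where C: "C > 0"
    and geodesic: "\<And>x y::'x. \<exists>a b (r :: real \<Rightarrow> 'x). a \<le> b \<and> r a = x \<and> r b = y \<and>
      (\<forall>t\<in>{a..b}. \<forall>u\<in>{a..b}. \<bar>t - u\<bar> - C \<le> dist (r t) (r u) \<and> dist (r t) (r u) \<le> \<bar>t - u\<bar> + C)"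
    unfolding roughly_geodesic_def by blast
  from assms(2) obtain K where K: "compact K" "(\<Union>\<gamma>\<in>\<Gamma>. \<gamma> ` K) = UNIV"
    unfolding cocompact_def by blast
  from K(1) obtain D where D: "\<And>x. x \<in> K \<Longrightarrow> dist z x \<le> D"
    using bounded_any_center[of K z] compact_imp_bounded by blast
  have near: "\<exists>\<gamma>\<in>\<Gamma>. dist (\<gamma> z) x \<le> D" for x
  proof -
    from K(2) obtain \<gamma> k where "\<gamma> \<in> \<Gamma>" "k \<in> K" "x = \<gamma> k"
      by blast
    then show ?thesis
      using D by (intro bexI[of _ \<gamma>]) (auto simp: dist_elem)
  qed
  have "D \<ge> 0"
    using near[of z] zero_le_dist order_trans by blast
  \<comment> \<open>The point at parameter b - \<tau> is at distance at most d(z, \<gamma> z) + 2 C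
    - \<tau> from z, and an orbit point lies within D of it; \<tau> is chosen to leave a net gain of
    1. R bounds the distance from that orbit point to \<gamma> z, and T0 forces b - a \<ge> \<tau>,
    so that the step stays on the path.\<close>
  define \<tau> where "\<tau> = 2 * C + D + 1"
  define R where "R = \<tau> + C + D"
  define T0 where "T0 = \<tau> + C"
  have T0: "T0 \<ge> 1"
    using C \<open>D \<ge> 0\<close> by (simp add: T0_def \<tau>_def)
  have step: "\<exists>g\<in>\<Gamma>. dist z (g z) \<le> dist z (\<gamma> z) - 1 \<and> dist (g z) (\<gamma> z) \<le> R"
    if \<gamma>: "\<gamma> \<in> \<Gamma>" "dist z (\<gamma> z) \<ge> T0" for \<gamma>
  proof -
    from geodesic[of z "\<gamma> z"] obtain a b r where r: "a \<le> b" "r a = z" "r b = \<gamma> z"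
      and rough: "\<And>t u. t \<in> {a..b} \<Longrightarrow> u \<in> {a..b} \<Longrightarrow>
        \<bar>t - u\<bar> - C \<le> dist (r t) (r u) \<and> dist (r t) (r u) \<le> \<bar>t - u\<bar> + C"
      by (elim exE conjE) blast
    have ab: "b - a - C \<le> dist z (\<gamma> z)" "dist z (\<gamma> z) \<le> b - a + C"
      using rough[of a b] r by auto
    have "\<tau> \<ge> 0"
      using C \<open>D \<ge> 0\<close> by (simp add: \<tau>_def)
    have "b - \<tau> \<in> {a..b}"
      using ab \<gamma>(2) \<open>\<tau> \<ge> 0\<close> by (simp add: T0_def)
    then have "dist z (r (b - \<tau>)) \<le> b - \<tau> - a + C" "dist (r (b - \<tau>)) (\<gamma> z) \<le> \<tau> + C"
      using rough[of a "b - \<tau>"] rough[of "b - \<tau>" b] r \<open>\<tau> \<ge> 0\<close> by auto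
    moreover from near obtain g where g: "g \<in> \<Gamma>" "dist (g z) (r (b - \<tau>)) \<le> D"
      by blast
    ultimately have "dist z (g z) \<le> dist z (\<gamma> z) - 1" "dist (g z) (\<gamma> z) \<le> R"
      using ab dist_triangle2[of z "g z" "r (b - \<tau>)"] dist_triangle[of "g z" "\<gamma> z" "r (b - \<tau>)"]
      unfolding R_def \<tau>_def by linarith+
    with g show ?thesis
      by blast
  qed
  define S where "S = {\<gamma>\<in>\<Gamma>. dist z (\<gamma> z) \<le> R}"
  define N where "N T = card {\<gamma>\<in>\<Gamma>. dist z (\<gamma> z) < T}" for T
  have S: "finite S" "id \<in> S"
    using finite_le id_closed C \<open>D \<ge> 0\<close> by (auto simp: S_def R_def \<tau>_def)
  have N_Suc: "N (T + 1) \<le> N T * card S" if "T \<ge> T0" for T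
  proof -
    have "{\<gamma>\<in>\<Gamma>. dist z (\<gamma> z) < T + 1} \<subseteq> (\<lambda>(g, s). g \<circ> s) ` ({\<gamma>\<in>\<Gamma>. dist z (\<gamma> z) < T} \<times> S)"
    proof
      fix \<gamma> assume \<gamma>: "\<gamma> \<in> {\<gamma>\<in>\<Gamma>. dist z (\<gamma> z) < T + 1}"
      show "\<gamma> \<in> (\<lambda>(g, s). g \<circ> s) ` ({\<gamma>\<in>\<Gamma>. dist z (\<gamma> z) < T} \<times> S)"
      proof (cases "dist z (\<gamma> z) < T")
        case True
        with \<gamma> S show ?thesis
          by (intro image_eqI[of _ _ "(\<gamma>, id)"]) auto
      next
        case False
        with \<gamma> \<open>T \<ge> T0\<close> obtain g where g: "g \<in> \<Gamma>" "dist z (g z) \<le> dist z (\<gamma> z) - 1" "dist (g z) (\<gamma> z) \<le> R"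
          using step[of \<gamma>] by auto
        have "dist z (inv_into UNIV g (\<gamma> z)) = dist (g z) (\<gamma> z)"
          using g dist_elem[of g z "inv_into UNIV g (\<gamma> z)"] by (simp add: apply_inv_into)
        with g \<gamma> have "inv_into UNIV g \<circ> \<gamma> \<in> S"
          by (simp add: S_def comp_closed inv_into_closed)
        moreover have "\<gamma> = g \<circ> (inv_into UNIV g \<circ> \<gamma>)"
          using g by (simp add: fun_eq_iff apply_inv_into)
        ultimately show ?thesis
          using g \<gamma> by (intro image_eqI[of _ _ "(g, inv_into UNIV g \<circ> \<gamma>)"]) auto
      qed
    qed
    then have "N (T + 1) \<le> card ({\<gamma>\<in>\<Gamma>. dist z (\<gamma> z) < T} \<times> S)"
      unfolding N_def using S finite_less by (intro surj_card_le) auto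
    then show ?thesis
      by (simp add: card_cartesian_product N_def)
  qed
  have N_add: "N (T0 + real n) \<le> N T0 * card S ^ n" for n
  proof (induction n)
    case (Suc n)
    have "N (T0 + real (Suc n)) \<le> N (T0 + real n) * card S"
      using N_Suc[of "T0 + real n"] by (simp add: add_ac)
    also have "\<dots> \<le> N T0 * card S ^ n * card S"
      using Suc by simp
    finally show ?case
      by (simp add: mult_ac)
  qed simp
  have pos: "card S \<ge> 1" "N T0 \<ge> 1"
    using S id_closed T0 finite_less[of T0] by (auto simp: Suc_le_eq card_gt_0_iff N_def intro!: exI[of _ id])
  \<comment> \<open>The number n of unit steps is at most T because T0 \<ge> 1, and T \<ge> 1 lets
    the constant factor \<open>N T0\<close> be absorbed into the exponent as well.\<close>
  define B where "B = ln (N T0) + ln (card S)"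
  have "real (N T) \<le> exp (B * T)" if "T \<ge> T0" for T
  proof -
    define n where "n = nat \<lceil>T - T0\<rceil>"
    have n: "T \<le> T0 + real n" "real n \<le> T"
      using that T0 unfolding n_def by linarith+
    have "N T \<le> N (T0 + real n)"
      unfolding N_def using n by (intro card_mono finite_less) auto
    also have "\<dots> \<le> N T0 * card S ^ n"
      by (rule N_add)
    finally have "real (N T) \<le> real (N T0) * real (card S) ^ n"
      by (metis of_nat_mono of_nat_mult of_nat_power)
    also have "\<dots> = exp (ln (N T0) + real n * ln (card S))"
      using pos by (simp add: exp_add exp_of_nat_mult)
    also have "ln (N T0) + real n * ln (card S) \<le> ln (N T0) * T + T * ln (card S)"
      using n pos that T0 mult_left_mono[of 1 T "ln (N T0)"] by (intro add_mono mult_right_mono) auto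
    finally show ?thesis
      by (simp add: B_def algebra_simps)
  qed
  then show ?thesis
    unfolding N_def by (intro that[of B]) (auto simp: eventually_at_top_linorder)
qed

section \<open>Exponential lower bound on growth\<close>

text \<open>The order of quantifiers is the point: c depends only on the three limit points, whereas
  going further along the sequences makes the legs as long as desired. This later allows L to be
  chosen in terms of c.\<close>

lemma tripods:
  assumes hyp: "gromov_hyperbolic TYPE('x) \<delta>" and "non_elementary \<Gamma> z"
  obtains c where "c \<ge> 0" "\<And>L. \<exists>a1\<in>\<Gamma>. \<exists>a2\<in>\<Gamma>. \<exists>a3\<in>\<Gamma>.
    L \<le> dist z (a1 z) \<and> L \<le> dist z (a2 z) \<and> L \<le> dist z (a3 z) \<and>
    gromov_product z (a1 z) (a2 z) \<le> c \<and> gromov_product z (a1 z) (a3 z) \<le> c \<and>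
    gromov_product z (a2 z) (a3 z) \<le> c"
proof -
  have "\<exists>A\<subseteq>limit_set \<Gamma> z. card A = 3"
  proof (cases "finite (limit_set \<Gamma> z)")
    case True
    with assms(2) have "3 \<le> card (limit_set \<Gamma> z)"
      by (simp add: non_elementary_def)
    then show ?thesis
      by (rule obtain_subset_with_card_n) blast
  next
    case False
    then show ?thesis
      using infinite_arbitrarily_large by blast
  qed
  then obtain \<xi>1 \<xi>2 \<xi>3 where \<xi>: "\<xi>1 \<in> limit_set \<Gamma> z" "\<xi>2 \<in> limit_set \<Gamma> z" "\<xi>3 \<in> limit_set \<Gamma> z"
    "\<xi>1 \<noteq> \<xi>2" "\<xi>1 \<noteq> \<xi>3" "\<xi>2 \<noteq> \<xi>3"
    by (auto simp: card_3_iff)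
  then obtain xs1 xs2 xs3 where xs: "xs1 \<in> \<xi>1" "xs2 \<in> \<xi>2" "xs3 \<in> \<xi>3"
    and orbit: "range xs1 \<subseteq> orbit_of \<Gamma> z" "range xs2 \<subseteq> orbit_of \<Gamma> z" "range xs3 \<subseteq> orbit_of \<Gamma> z"
    by (auto simp: limit_set_def)
  note eqv = equiv_boundary_rel[OF hyp, of z]
  have \<xi>_quot: "\<xi>1 \<in> converging_to_infinity z // boundary_rel z"
    "\<xi>2 \<in> converging_to_infinity z // boundary_rel z" "\<xi>3 \<in> converging_to_infinity z // boundary_rel z"
    using \<xi> by (auto simp: limit_set_def gromov_boundary_def)
  then have conv: "xs1 \<in> converging_to_infinity z" "xs2 \<in> converging_to_infinity z" "xs3 \<in> converging_to_infinity z"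
    using xs in_quotient_imp_subset[OF eqv] by blast+
  have not_rel: "(xs, ys) \<notin> boundary_rel z"
    if "\<xi> \<in> converging_to_infinity z // boundary_rel z" "\<xi>' \<in> converging_to_infinity z // boundary_rel z"
      "xs \<in> \<xi>" "ys \<in> \<xi>'" "\<xi> \<noteq> \<xi>'" for xs ys \<xi> \<xi>'
    using quotient_eqI[OF eqv that(1-4)] that(5) by blast
  obtain c12 N12 where N12: "\<forall>i\<ge>N12. \<forall>j\<ge>N12. gromov_product z (xs1 i) (xs2 j) \<le> c12"
    using gromov_product_bounded_if_not_boundary_rel[OF hyp conv(1,2) not_rel[OF \<xi>_quot(1,2) xs(1,2) \<xi>(4)]] by blast
  obtain c13 N13 where N13: "\<forall>i\<ge>N13. \<forall>j\<ge>N13. gromov_product z (xs1 i) (xs3 j) \<le> c13"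
    using gromov_product_bounded_if_not_boundary_rel[OF hyp conv(1,3) not_rel[OF \<xi>_quot(1,3) xs(1,3) \<xi>(5)]] by blast
  obtain c23 N23 where N23: "\<forall>i\<ge>N23. \<forall>j\<ge>N23. gromov_product z (xs2 i) (xs3 j) \<le> c23"
    using gromov_product_bounded_if_not_boundary_rel[OF hyp conv(2,3) not_rel[OF \<xi>_quot(2,3) xs(2,3) \<xi>(6)]] by blast
  define c where "c = Max {0, c12, c13, c23}"
  have c: "c \<ge> 0" "c12 \<le> c" "c13 \<le> c" "c23 \<le> c"
    by (auto simp: c_def)
  show ?thesis
  proof (rule that[OF c(1)])
    fix L
    \<comment> \<open>The diagonal i = j of convergence to infinity, since the Gromov product of a
      point with itself is its distance from the base point.\<close>
    have far: "\<exists>N. \<forall>i\<ge>N. L \<le> dist z (xs i)" if xs: "xs \<in> converging_to_infinity z" for xs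
    proof -
      from xs obtain N where "\<forall>i\<ge>N. \<forall>j\<ge>N. L \<le> gromov_product z (xs i) (xs j)"
        unfolding converging_to_infinity_iff by blast
      then have "\<forall>i\<ge>N. L \<le> gromov_product z (xs i) (xs i)"
        by blast
      then show ?thesis
        by (auto simp: dist_commute)
    qed
    from far[OF conv(1)] far[OF conv(2)] far[OF conv(3)] obtain N1 N2 N3
      where N: "\<forall>i\<ge>N1. L \<le> dist z (xs1 i)" "\<forall>i\<ge>N2. L \<le> dist z (xs2 i)" "\<forall>i\<ge>N3. L \<le> dist z (xs3 i)"
      by blast
    define n where "n = Max {N1, N2, N3, N12, N13, N23}"
    have n: "n \<ge> N1" "n \<ge> N2" "n \<ge> N3" "n \<ge> N12" "n \<ge> N13" "n \<ge> N23"
      by (auto simp: n_def)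
    have "xs1 n \<in> orbit_of \<Gamma> z" "xs2 n \<in> orbit_of \<Gamma> z" "xs3 n \<in> orbit_of \<Gamma> z"
      using orbit by blast+
    then obtain a1 a2 a3 where a: "a1 \<in> \<Gamma>" "a2 \<in> \<Gamma>" "a3 \<in> \<Gamma>" "xs1 n = a1 z" "xs2 n = a2 z" "xs3 n = a3 z"
      unfolding orbit_of_def by (elim imageE)
    show "\<exists>a1\<in>\<Gamma>. \<exists>a2\<in>\<Gamma>. \<exists>a3\<in>\<Gamma>.
      L \<le> dist z (a1 z) \<and> L \<le> dist z (a2 z) \<and> L \<le> dist z (a3 z) \<and>
      gromov_product z (a1 z) (a2 z) \<le> c \<and> gromov_product z (a1 z) (a3 z) \<le> c \<and>
      gromov_product z (a2 z) (a3 z) \<le> c"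
      using a N n c N12[rule_format, of n n] N13[rule_format, of n n] N23[rule_format, of n n]
      by (intro bexI[of _ a1] bexI[of _ a2] bexI[of _ a3]) auto
  qed
qed

text \<open>For \<open>\<gamma> \<in> \<Gamma>\<close> and any direction \<open>u\<close> seen from \<open>\<gamma> z\<close>, at most one leg of the translated tripod
  points towards \<open>u\<close>; the other two carry the subtrees. The bound on the Gromov product with \<open>u\<close>
  is the invariant that keeps their leaves apart.\<close>

lemma exponentially_many_orbit_points:
  assumes hyp: "gromov_hyperbolic TYPE('x) \<delta>" and "non_elementary \<Gamma> z"
  obtains M where "M > 0"
    "\<And>n. \<exists>P\<subseteq>orbit_of \<Gamma> z. finite P \<and> card P = 2 ^ n \<and> (\<forall>q\<in>P. dist z q \<le> real n * M)"
proof -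
  have \<delta>: "\<delta> \<ge> 0"
    using hyp by (simp add: gromov_hyperbolic_def)
  from tripods[OF assms] obtain c where c: "c \<ge> 0" and tripod: "\<And>L. \<exists>a1\<in>\<Gamma>. \<exists>a2\<in>\<Gamma>. \<exists>a3\<in>\<Gamma>.
    L \<le> dist z (a1 z) \<and> L \<le> dist z (a2 z) \<and> L \<le> dist z (a3 z) \<and>
    gromov_product z (a1 z) (a2 z) \<le> c \<and> gromov_product z (a1 z) (a3 z) \<le> c \<and>
    gromov_product z (a2 z) (a3 z) \<le> c"
    by metis
  \<comment> \<open>An edge of this length, minus the backward product of at most c + 2 \<delta>
    allowed by the invariant, leaves a forward product above c + 2 \<delta>.\<close>
  define L where "L = 2 * c + 4 * \<delta> + 1"
  from tripod[of L] obtain a1 a2 a3 where a: "a1 \<in> \<Gamma>" "a2 \<in> \<Gamma>" "a3 \<in> \<Gamma>"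
    and far: "L \<le> dist z (a1 z)" "L \<le> dist z (a2 z)" "L \<le> dist z (a3 z)"
    and apart: "gromov_product z (a1 z) (a2 z) \<le> c" "gromov_product z (a1 z) (a3 z) \<le> c"
      "gromov_product z (a2 z) (a3 z) \<le> c"
    by blast
  define V where "V = {a1, a2, a3}"
  define M where "M = Max ((\<lambda>a. dist z (a z)) ` V)"
  have V: "a \<in> \<Gamma>" "L \<le> dist z (a z)" "dist z (a z) \<le> M" if "a \<in> V" for a
    using that a far by (auto simp: V_def M_def)
  have M: "M > 0"
    using V(2,3)[of a1] c \<delta> by (simp add: V_def L_def)
  have branch: "\<exists>a\<in>V. \<exists>b\<in>V. gromov_product z (a z) (b z) \<le> c \<and>
      gromov_product z u (a z) \<le> c + \<delta> \<and> gromov_product z u (b z) \<le> c + \<delta>" for u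
  proof -
    \<comment> \<open>If both products with u exceeded c + \<delta>, the four-point inequality would
      push the product of the two legs above c. Applied to all three pairs this leaves at least two
      good legs.\<close>
    have one: "gromov_product z u (a z) \<le> c + \<delta> \<or> gromov_product z u (b z) \<le> c + \<delta>"
      if "gromov_product z (a z) (b z) \<le> c" for a b
      using gromov_hyperbolicD[OF hyp, of z "a z" u "b z"] that gromov_product_commute[of z u "a z"] by linarith
    show ?thesis
      using one[of a1 a2] one[of a1 a3] one[of a2 a3] apart unfolding V_def by blast
  qed
  have tree: "\<exists>P\<subseteq>orbit_of \<Gamma> z. finite P \<and> card P = 2 ^ n \<and>
      (\<forall>q\<in>P. dist (\<gamma> z) q \<le> real n * M \<and> gromov_product (\<gamma> z) u q \<le> c + 2 * \<delta>)"
    if "\<gamma> \<in> \<Gamma>" for n \<gamma> u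
    using that
  proof (induction n arbitrary: \<gamma> u)
    case 0
    then show ?case
      using c \<delta> by (intro exI[of _ "{\<gamma> z}"]) (auto simp: orbit_of_def gromov_product_commute[of _ u])
  next
    case (Suc n)
    let ?u = "inv_into UNIV \<gamma> u"
    obtain a b where ab: "a \<in> V" "b \<in> V" "gromov_product z (a z) (b z) \<le> c"
      "gromov_product z ?u (a z) \<le> c + \<delta>" "gromov_product z ?u (b z) \<le> c + \<delta>"
      using branch[of ?u] by blast
    have leg: "\<exists>P\<subseteq>orbit_of \<Gamma> z. finite P \<and> card P = 2 ^ n \<and>
      (\<forall>q\<in>P. dist (\<gamma> z) q \<le> real (Suc n) * M \<and> gromov_product (\<gamma> z) u q \<le> c + 2 * \<delta> \<and>
        c + \<delta> < gromov_product (\<gamma> z) q (\<gamma> (d z)))"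
      if d: "d \<in> V" "gromov_product z ?u (d z) \<le> c + \<delta>" for d
    proof -
      have "\<gamma> \<circ> d \<in> \<Gamma>"
        using d V Suc.prems by (simp add: comp_closed)
      \<comment> \<open>The subtree at the end of the leg is told to avoid its parent
        \<open>\<gamma> z\<close>; the direction u seen from the parent is handled
        separately.\<close>
      from Suc.IH[OF this, of "\<gamma> z"] obtain P where P: "P \<subseteq> orbit_of \<Gamma> z" "finite P" "card P = 2 ^ n"
        and q: "\<And>q. q \<in> P \<Longrightarrow> dist (\<gamma> (d z)) q \<le> real n * M \<and> gromov_product (\<gamma> (d z)) (\<gamma> z) q \<le> c + 2 * \<delta>"
        by auto
      have edge: "dist (\<gamma> z) (\<gamma> (d z)) = dist z (d z)"
        using Suc.prems by (simp add: dist_elem)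
      have behind: "gromov_product (\<gamma> z) u (\<gamma> (d z)) \<le> c + \<delta>"
        using gromov_product_elem[OF Suc.prems, of z ?u "d z"] d(2) Suc.prems by (simp add: apply_inv_into)
      have "dist (\<gamma> z) q \<le> real (Suc n) * M \<and> gromov_product (\<gamma> z) u q \<le> c + 2 * \<delta> \<and>
        c + \<delta> < gromov_product (\<gamma> z) q (\<gamma> (d z))" if "q \<in> P" for q
      proof -
        \<comment> \<open>The Gromov products of q with the opposite endpoint, taken at the two ends
          of an edge, add up to the length of the edge.\<close>
        have "gromov_product (\<gamma> z) q (\<gamma> (d z)) = dist z (d z) - gromov_product (\<gamma> (d z)) (\<gamma> z) q"
          unfolding edge[symmetric] by (simp add: gromov_product_def dist_commute field_simps)
        then have fwd: "c + 2 * \<delta> < gromov_product (\<gamma> z) q (\<gamma> (d z))"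
          using V(2)[OF d(1)] q[OF that] by (simp add: L_def)
        \<comment> \<open>The leaf points along the leg and u does not, so u and the leaf cannot
          share a direction beyond c + 2 \<delta>: the invariant is restored with the same
          constant.\<close>
        then have "gromov_product (\<gamma> z) u q \<le> c + 2 * \<delta>"
          using gromov_hyperbolicD[OF hyp, of "\<gamma> z" u q "\<gamma> (d z)"] behind by linarith
        moreover have "dist (\<gamma> z) q \<le> real (Suc n) * M"
          using dist_triangle[of "\<gamma> z" q "\<gamma> (d z)"] edge V(3)[OF d(1)] q[OF that] by (simp add: algebra_simps)
        ultimately show ?thesis
          using fwd \<delta> by simp
      qed
      with P show ?thesis
        by blast
    qed
    from leg[OF ab(1,4)] obtain P where P: "P \<subseteq> orbit_of \<Gamma> z" "finite P" "card P = 2 ^ n"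
      and qP: "\<And>q. q \<in> P \<Longrightarrow> dist (\<gamma> z) q \<le> real (Suc n) * M \<and> gromov_product (\<gamma> z) u q \<le> c + 2 * \<delta> \<and>
        c + \<delta> < gromov_product (\<gamma> z) q (\<gamma> (a z))"
      by blast
    from leg[OF ab(2,5)] obtain Q where Q: "Q \<subseteq> orbit_of \<Gamma> z" "finite Q" "card Q = 2 ^ n"
      and qQ: "\<And>q. q \<in> Q \<Longrightarrow> dist (\<gamma> z) q \<le> real (Suc n) * M \<and> gromov_product (\<gamma> z) u q \<le> c + 2 * \<delta> \<and>
        c + \<delta> < gromov_product (\<gamma> z) q (\<gamma> (b z))"
      by blast
    have "P \<inter> Q = {}"
    proof (rule ccontr)
      assume "P \<inter> Q \<noteq> {}"
      then obtain q where q: "q \<in> P" "q \<in> Q"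
        by blast
      have "gromov_product (\<gamma> z) (\<gamma> (a z)) (\<gamma> (b z)) \<le> c"
        using ab Suc.prems by (simp add: gromov_product_elem)
      \<comment> \<open>A common leaf would have product above c + \<delta> with both legs, hence
        the legs would have product above c with each other.\<close>
      then show False
        using gromov_hyperbolicD[OF hyp, of "\<gamma> z" "\<gamma> (a z)" q "\<gamma> (b z)"] qP[OF q(1)] qQ[OF q(2)]
          gromov_product_commute[of "\<gamma> z" q "\<gamma> (a z)"] by linarith
    qed
    then have "card (P \<union> Q) = 2 ^ Suc n"
      using P Q by (simp add: card_Un_disjoint)
    with P Q qP qQ show ?case
      by (intro exI[of _ "P \<union> Q"]) blast
  qed
  show ?thesis
  proof (rule that[OF M])
    fix n
    from tree[OF id_closed, of n z] obtain P where "P \<subseteq> orbit_of \<Gamma> z" "finite P" "card P = 2 ^ n"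
      "\<forall>q\<in>P. dist z q \<le> real n * M"
      by auto
    then show "\<exists>P\<subseteq>orbit_of \<Gamma> z. finite P \<and> card P = 2 ^ n \<and> (\<forall>q\<in>P. dist z q \<le> real n * M)"
      by blast
  qed
qed

section \<open>Volume growth and the Poincare series\<close>

text \<open>\<open>real_of_ereal\<close> sends infinite values to 0, so the limsup has to be bounded
  on both sides before \<open>volume_growth\<close> can stand for it. The tree supplies 2 ^ n orbit
  points within n M.\<close>

lemma volume_growth_finite_pos:
  assumes "roughly_geodesic TYPE('x)" and "cocompact \<Gamma>"
    and "gromov_hyperbolic TYPE('x) \<delta>" and "non_elementary \<Gamma> z"
  shows "ereal (volume_growth \<Gamma> z)
      = Limsup at_top (\<lambda>T. ereal (ln (real (card (orbit_of \<Gamma> z \<inter> ball z T))) / T))" (is ?finite)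
    and "0 < volume_growth \<Gamma> z"
proof -
  let ?f = "\<lambda>T. ereal (ln (real (card (orbit_of \<Gamma> z \<inter> ball z T))) / T)"
  obtain B where B: "eventually (\<lambda>T. real (card {\<gamma>\<in>\<Gamma>. dist z (\<gamma> z) < T}) \<le> exp (B * T)) at_top"
    using exponential_growth_bound[OF assms(1,2)] by blast
  have "eventually (\<lambda>T. ?f T \<le> ereal B) at_top"
    using B eventually_gt_at_top[of 0]
  proof eventually_elim
    case (elim T)
    have "real (card (orbit_of \<Gamma> z \<inter> ball z T)) \<le> exp (B * T)"
      using elim(1) card_orbit_le[of T] by linarith
    then have "ln (real (card (orbit_of \<Gamma> z \<inter> ball z T))) \<le> B * T"
      using card_orbit_pos[OF elim(2)] by (simp add: ln_le_iff_le_exp)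
    with elim(2) show ?case
      by (simp add: divide_le_eq)
  qed
  then have upper: "Limsup at_top ?f \<le> ereal B"
    by (rule Limsup_bounded)
  from exponentially_many_orbit_points[OF assms(3,4)] obtain M where M: "M > 0"
    and many: "\<And>n. \<exists>P\<subseteq>orbit_of \<Gamma> z. finite P \<and> card P = 2 ^ n \<and> (\<forall>q\<in>P. dist z q \<le> real n * M)"
    by metis
  have lower: "ereal (ln 2 / (2 * M)) \<le> Limsup at_top ?f"
  proof (rule ccontr)
    assume "\<not> ereal (ln 2 / (2 * M)) \<le> Limsup at_top ?f"
    then have "eventually (\<lambda>T. ?f T < ereal (ln 2 / (2 * M))) at_top"
      by (intro Limsup_lessD) simp
    then obtain T0 where T0: "\<And>T. T \<ge> T0 \<Longrightarrow> ?f T < ereal (ln 2 / (2 * M))"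
      unfolding eventually_at_top_linorder by blast
    obtain n where n: "n \<ge> (1::nat)" "T0 \<le> real n * M"
    proof -
      obtain k where "T0 / M \<le> real k"
        using real_arch_simple by blast
      with M show ?thesis
        by (intro that[of "Suc k"]) (auto simp: field_simps intro: order_trans)
    qed
    \<comment> \<open>Balls are open, so the radius is enlarged to (n + 1) M; as n \<ge> 1 this is
      at most 2 n M, which explains the denominator 2 M.\<close>
    define T where "T = real (n + 1) * M"
    have T: "T > 0" "T \<ge> T0"
      using n M by (simp_all add: T_def algebra_simps add_pos_nonneg)
    from many[of n] obtain P where P: "P \<subseteq> orbit_of \<Gamma> z" "card P = 2 ^ n" "\<forall>q\<in>P. dist z q \<le> real n * M"
      by blast
    have "P \<subseteq> orbit_of \<Gamma> z \<inter> ball z T"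
      using P M by (auto simp: T_def algebra_simps intro: le_less_trans)
    then have "2 ^ n \<le> card (orbit_of \<Gamma> z \<inter> ball z T)"
      using card_mono[OF finite_orbit_Int_ball] P by metis
    then have "(2::real) ^ n \<le> real (card (orbit_of \<Gamma> z \<inter> ball z T))"
      by (metis numeral_power_le_of_nat_cancel_iff)
    then have "ln (2 ^ n :: real) \<le> ln (real (card (orbit_of \<Gamma> z \<inter> ball z T)))"
      using card_orbit_pos[OF T(1)] by (intro ln_mono) auto
    then have "real n * ln 2 / T \<le> ln (real (card (orbit_of \<Gamma> z \<inter> ball z T))) / T"
      using T by (simp add: ln_realpow divide_right_mono)
    moreover have "ln 2 / (2 * M) \<le> real n * ln 2 / T"
    proof -
      have "T \<le> real n * (2 * M)"
        using n M by (simp add: T_def algebra_simps)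
      then show ?thesis
        using T M by (simp add: divide_le_eq le_divide_eq mult_left_mono field_simps)
    qed
    ultimately show False
      using T0[OF T(2)] by simp
  qed
  obtain l where l: "Limsup at_top ?f = ereal l"
    using upper lower by (cases "Limsup at_top ?f") auto
  then show ?finite
    by (simp add: volume_growth_def)
  with l lower have "ln 2 / (2 * M) \<le> volume_growth \<Gamma> z"
    by simp
  moreover have "0 < ln 2 / (2 * M)"
    using M by simp
  ultimately show "0 < volume_growth \<Gamma> z"
    by linarith
qed

text \<open>Convergence of the Poincare series beyond the growth exponent. The midpoint u leaves
  room on both sides: being above the limsup it bounds the count eventually, and being below t it
  gives a convergent geometric series.\<close>

lemma poincare_series_bounded:
  assumes "roughly_geodesic TYPE('x)" and "cocompact \<Gamma>"
    and "gromov_hyperbolic TYPE('x) \<delta>" and "non_elementary \<Gamma> z"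
    and t: "volume_growth \<Gamma> z < t"
  shows "\<exists>B. \<forall>F. finite F \<longrightarrow> F \<subseteq> \<Gamma> \<longrightarrow> (\<Sum>\<gamma>\<in>F. exp (- t * dist z (\<gamma> z))) \<le> B"
proof -
  define u where "u = (volume_growth \<Gamma> z + t) / 2"
  define m where "m = card {\<gamma>\<in>\<Gamma>. \<gamma> z = z}"
  have u: "0 \<le> u" "volume_growth \<Gamma> z < u" "u < t"
    using t volume_growth_finite_pos(2)[OF assms(1-4)] by (auto simp: u_def)
  have "Limsup at_top (\<lambda>T. ereal (ln (real (card (orbit_of \<Gamma> z \<inter> ball z T))) / T)) < ereal u"
    using u volume_growth_finite_pos(1)[OF assms(1-4)] by (metis less_ereal.simps(1))
  then have "eventually (\<lambda>T. ereal (ln (real (card (orbit_of \<Gamma> z \<inter> ball z T))) / T) < ereal u) at_top"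
    by (rule Limsup_lessD)
  then have "eventually (\<lambda>T. real (card {\<gamma>\<in>\<Gamma>. dist z (\<gamma> z) < T}) \<le> real m * exp (u * T)) at_top"
    using eventually_gt_at_top[of 0]
  proof eventually_elim
    case (elim T)
    then have "ln (real (card (orbit_of \<Gamma> z \<inter> ball z T))) \<le> u * T"
      by (simp add: divide_less_eq)
    then have "real (card (orbit_of \<Gamma> z \<inter> ball z T)) \<le> exp (u * T)"
      using card_orbit_pos[OF elim(2)] by (simp add: ln_le_iff_le_exp)
    then have "real m * real (card (orbit_of \<Gamma> z \<inter> ball z T)) \<le> real m * exp (u * T)"
      by (rule mult_left_mono) simp
    moreover have "real (card {\<gamma>\<in>\<Gamma>. dist z (\<gamma> z) < T}) \<le> real m * real (card (orbit_of \<Gamma> z \<inter> ball z T))"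
      using card_le_stabilizer_card_orbit[of T] unfolding m_def of_nat_mult[symmetric] by (rule of_nat_mono)
    ultimately show ?case
      by linarith
  qed
  from sum_exp_bounded_if_exponential_growth[OF zero_le_dist finite_less this u(1,3)]
  show ?thesis
    by metis
qed

text \<open>Infinitude follows from the tree: an orbit of k points would have to contain 2 ^ k of
  them.\<close>

lemma countable_length_group:
  assumes "gromov_hyperbolic TYPE('x) \<delta>" and "non_elementary \<Gamma> z"
  shows "countable_length_group (group_of \<Gamma>) (\<lambda>\<gamma>. dist z (\<gamma> z))"
proof -
  interpret subgroup \<Gamma> "BijGroup UNIV"
    by (rule subgroup_BijGroup)
  interpret G: group "group_of \<Gamma>"
    by (rule subgroup_is_group[OF group_BijGroup])
  have "infinite \<Gamma>"
  proof
    assume "finite \<Gamma>"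
    then have fin: "finite (orbit_of \<Gamma> z)"
      by (simp add: orbit_of_def)
    obtain P where "P \<subseteq> orbit_of \<Gamma> z" "card P = 2 ^ card (orbit_of \<Gamma> z)"
      using exponentially_many_orbit_points[OF assms] by metis
    with card_mono[OF fin] have "2 ^ card (orbit_of \<Gamma> z) \<le> card (orbit_of \<Gamma> z)"
      by metis
    then show False
      using less_exp[of "card (orbit_of \<Gamma> z)"] by linarith
  qed
  then show ?thesis
    using countable_group
    by unfold_locales
      (auto simp: one_eq_id mult_eq_comp dist_comp[simplified] m_inv_eq_inv dist_inv_into
        group.m_inv_consistent[OF group_BijGroup subgroup_BijGroup])
qed

end

theorem theorem1p6:
  fixes x\<^sub>0 :: "'x::metric_space" and \<Gamma> :: "('x \<Rightarrow> 'x) set"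
    and len :: "('x \<Rightarrow> 'x) \<Rightarrow> real" and \<alpha> :: real
  assumes "proper_space TYPE('x)"
    and "roughly_geodesic TYPE('x)"
    and "strongly_hyperbolic TYPE('x)"
    and "isometry_group \<Gamma>"
    and "properly_discontinuous \<Gamma>"
    and "non_elementary \<Gamma> x\<^sub>0"
    and "cocompact \<Gamma>"
  defines "len \<equiv> (\<lambda>\<gamma>. dist x\<^sub>0 (\<gamma> x\<^sub>0))"
    and "\<alpha> \<equiv> volume_growth \<Gamma> x\<^sub>0"
  shows "\<exists>C>0. \<exists>\<epsilon>\<in>{0<..<1/2}. \<exists>(H :: (nat \<Rightarrow> complex) chilbert) \<rho>.
    chilbert_space H \<and>
    (\<forall>s\<in>{0..1/2}. hilbert_representation (group_of \<Gamma>) H (\<rho> s)) \<and>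
    (\<forall>s\<in>{0..<1/2}. \<forall>\<gamma>\<in>\<Gamma>.
      op_norm H (\<rho> s \<gamma>) \<le> C * (exp (\<bar>1 - 2 * s\<bar> * \<alpha> * len \<gamma>) / (1 - exp (2 * s - 1))\<^sup>2)) \<and>
    unitary_representation (group_of \<Gamma>) H (\<rho> (1/2)) \<and>
    (\<forall>s\<in>{0..1/2 - \<epsilon>}. \<exists>b. cocycle (group_of \<Gamma>) H (\<rho> s) b \<and>
      proper_map_on (group_of \<Gamma>) len H b)"
proof -
  interpret discrete_isometry_group \<Gamma> x\<^sub>0
    by unfold_locales (rule assms)+
  obtain \<delta> where hyp: "gromov_hyperbolic TYPE('x) \<delta>"
    using strongly_hyperbolic_imp_gromov_hyperbolic[OF assms(3)] by blast
  interpret countable_length_group "group_of \<Gamma>" len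
    unfolding len_def by (rule countable_length_group[OF hyp assms(6)])
  have \<alpha>: "\<alpha> > 0"
    unfolding \<alpha>_def by (rule volume_growth_finite_pos(2)[OF assms(2,7) hyp assms(6)])
  have summable: "summable (\<lambda>n. exp (- t * len (elt n)))" if t: "\<alpha> < t" for t
  proof -
    obtain B where B: "\<forall>F. finite F \<longrightarrow> F \<subseteq> \<Gamma> \<longrightarrow> (\<Sum>\<gamma>\<in>F. exp (- t * len \<gamma>)) \<le> B"
      using poincare_series_bounded[OF assms(2,7) hyp assms(6) t[unfolded \<alpha>_def]]
      unfolding len_def by blast
    show ?thesis
    proof (rule bounded_imp_summable)
      fix n
      have "inj_on elt {..n}"
        by (metis idx_elt inj_onI)
      then have "(\<Sum>k\<le>n. exp (- t * len (elt k))) = (\<Sum>\<gamma>\<in>elt ` {..n}. exp (- t * len \<gamma>))"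
        by (simp add: sum.reindex)
      also have "\<dots> \<le> B"
        using elt_closed by (intro B[rule_format]) auto
      finally show "(\<Sum>k\<le>n. exp (- t * len (elt k))) \<le> B" .
    qed simp
  qed
  define \<rho> where "\<rho> s = twisted_rep ((1 - 2 * s) * \<alpha>)" for s
  have \<beta>: "(1 - 2 * s) * \<alpha> \<ge> 0" if "s \<le> 1/2" for s
    using that \<alpha> by (intro mult_nonneg_nonneg) auto
  show ?thesis
  \<comment> \<open>With \<epsilon> = 3/8 the range in (iii) is s \<le> 1/8, where 2 \<beta> \<ge>
    (3/2) \<alpha> > \<alpha>; any \<epsilon> strictly between 1/4 and 1/2 would serve.\<close>
  proof (intro exI[of _ "1::real"] bexI[of _ "3/8::real"] exI[of _ ell2] exI[of _ \<rho>] conjI ballI)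
    show "chilbert_space ell2"
      by (rule chilbert_space_ell2)
    show "hilbert_representation (group_of \<Gamma>) ell2 (\<rho> s)" if "s \<in> {0..1/2}" for s
      unfolding \<rho>_def using that by (intro twisted_rep_is_rep \<beta>) simp
    show "unitary_representation (group_of \<Gamma>) ell2 (\<rho> (1/2))"
      using unitary_twisted_rep_0 by (simp add: \<rho>_def)
  next
    fix s :: real and \<gamma> assume s: "s \<in> {0..<1/2}" and \<gamma>: "\<gamma> \<in> \<Gamma>"
    have "op_norm ell2 (\<rho> s \<gamma>) \<le> exp ((1 - 2 * s) * \<alpha> * len \<gamma>)"
      unfolding \<rho>_def using s \<gamma> by (intro op_norm_twisted_rep_le \<beta>) auto
    \<comment> \<open>For s < 1/2 the denominator lies in (0, 1], so dividing by it only enlarges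
      the bound; this is why C = 1 is enough.\<close>
    also have "\<dots> \<le> exp ((1 - 2 * s) * \<alpha> * len \<gamma>) / (1 - exp (2 * s - 1))\<^sup>2"
    proof -
      have "0 < 1 - exp (2 * s - 1)" "1 - exp (2 * s - 1) \<le> 1"
        using s by auto
      then have "0 < (1 - exp (2 * s - 1))\<^sup>2" "(1 - exp (2 * s - 1))\<^sup>2 \<le> 1"
        by (auto simp: power_le_one)
      then show ?thesis
        by (simp add: le_divide_eq mult_left_le)
    qed
    finally show "op_norm ell2 (\<rho> s \<gamma>)
        \<le> 1 * (exp (\<bar>1 - 2 * s\<bar> * \<alpha> * len \<gamma>) / (1 - exp (2 * s - 1))\<^sup>2)"
      using s by simp
  next
    fix s :: real assume s: "s \<in> {0..1/2 - 3/8}"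
    have "(1 - 2 * s) * \<alpha> \<ge> 3/4 * \<alpha>"
      using s \<alpha> by (intro mult_right_mono) auto
    then have "summable (\<lambda>n. exp (- (2 * ((1 - 2 * s) * \<alpha>)) * len (elt n)))"
      using \<alpha> by (intro summable) linarith
    then have "summable (\<lambda>n. exp (- 2 * ((1 - 2 * s) * \<alpha>) * len (elt n)))"
      by (simp only: mult_minus_left)
    from len_cocycle_proper_cocycle[OF \<beta> this] s
    show "\<exists>b. cocycle (group_of \<Gamma>) ell2 (\<rho> s) b \<and> proper_map_on (group_of \<Gamma>) len ell2 b"
      unfolding \<rho>_def by (intro exI[of _ "len_cocycle ((1 - 2 * s) * \<alpha>)"]) auto
  qed auto
qed

end
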